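(* Let $R$ be a commutative profinite ring, $G$ a profinite group, $T$ a compact $R[[G]]$-module finitely generated over $R$, $a,b\ge0$ integers with $n=a+b\ge 2$, and let $(\phi,\theta)$ be a partial defining system, i.e. continuous homomorphisms $\phi\colon G\to\mathrm{U}_{a+1}(R)$, $\theta\colon G\to\mathrm{U}_{b+1}(R)$; write $\alpha_i=\phi_{i,i+1}$ ($1\le i\le a$) and $\beta_i=\theta_{i,i+1}$ ($1\le i\le b$). Let $\kappa'\in Z^1(G,\mathfrak{U}'_{\phi,\theta}(T))$ and let $\rho=\begin{pmatrix}\phi&\kappa'\theta\\0&\theta\end{pmatrix}$ be the associated proper defining system. Then the image of the class of $\kappa'$ under the connecting map $\partial\colon H^1(G,\mathfrak{U}'_{\phi,\theta}(T))\to H^2(G,T)$ of the short exact sequence $0\to T\to\mathfrak{U}_{\phi,\theta}(T)\to\mathfrak{U}'_{\phi,\theta}(T)\to 0$ is the $(n+1)$-fold Massey product $(\alpha_1,\dots,\alpha_a,\kappa'_{a+1,1},\beta_1,\dots,\beta_b)_\rho$.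
   Context: $\mathrm{U}_k(R)$ is the group of $k\times k$ upper-triangular unipotent matrices over $R$. $\mathfrak{U}_{\phi,\theta}(T)$ is the $R$-module $M_{a+1,b+1}(T)$ with continuous $G$-action $g\star X = \phi(g)\cdot (gX)\cdot\theta(g)^{-1}$ ($gX$: $g$ applied entrywise). It contains $T$ as the $R[[G]]$-submodule of matrices zero outside the $(1,b+1)$-entry, and $\mathfrak{U}'_{\phi,\theta}(T)=\mathfrak{U}_{\phi,\theta}(T)/T$. Let $\mathcal{U}=\mathcal{U}_{n+2}(T,a+1)$ be the group of $(n+2)\times(n+2)$ block matrices $\begin{pmatrix}P&X\\0&Q\end{pmatrix}$ with $P\in\mathrm{U}_{a+1}(R)$, $Q\in\mathrm{U}_{b+1}(R)$, $X\in M_{a+1,b+1}(T)$, with usual matrix multiplication (using the $R$-module structure of $T$) and $G$ acting on the entries of $X$ via $T$; let $\mathcal{U}'=\mathcal{U}'_{n+2}(T,a+1)$ be the quotient by the central subgroup of matrices with $P,Q$ the identity and $X$ zero outside its $(1,b+1)$-entry (so its upper-right block lies in $M'_{a+1,b+1}(T)=M_{a+1,b+1}(T)/T$). A proper defining system relative to $(\phi,\theta)$ is a continuous map $\rho\colon G\to\mathcal{U}'$ with $\rho(gh)=\rho(g)\cdot g\rho(h)$ of the form $\begin{pmatrix}\phi&\kappa\\0&\theta\end{pmatrix}$. For such $\rho$ let $\tilde\rho\colon G\to\mathcal{U}$ be the lift with $(1,n+2)$-entry $0$, with entries $\rho_{i,j}$. The Massey product $(\alpha_1,\dots,\alpha_a,\lambda,\beta_1,\dots,\beta_b)_\rho\in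 H^2(G,T)$, where $\lambda=\rho_{a+1,a+2}$, is the class of the $2$-cocycle $(g,h)\mapsto\sum_{i=2}^{n+1}\rho_{1,i}(g)\,g\rho_{i,n+2}(h)$, i.e. the $(1,n+2)$-entry of $\tilde\rho(g)\cdot g\tilde\rho(h)$. *)

theory Defs
  imports
    "HOL-Analysis.T1_Spaces"
    "HOL-Analysis.Product_Topology"
    "HOL-Analysis.Function_Topology"
    "HOL-Algebra.Product_Groups"
    "HOL-Algebra.Module"
begin

section \<open>Topological algebraic structures\<close>

record 'a tgroup = "'a monoid" +
  gtop :: "'a topology"

record 'r tring = "'r ring" +
  rtop :: "'r topology"

text \<open>A group (usually abelian, written multiplicatively as everywhere in HOL-Algebra) with a
  topology and an action of \<open>'g\<close>; used for coefficient modules and for the non-abelian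
  group of block matrices.\<close>

record ('g, 'm) gmod = "'m tgroup" +
  act :: "'g \<Rightarrow> 'm \<Rightarrow> 'm"

record ('g, 'r, 't) rgmod = "('r, 't) module" +
  mtop :: "'t topology"
  mact :: "'g \<Rightarrow> 't \<Rightarrow> 't"

definition profinite_space :: "'a topology \<Rightarrow> bool" where
  "profinite_space X \<longleftrightarrow> compact_space X \<and> Hausdorff_space X \<and>
     (\<forall>S. connectedin X S \<longrightarrow> (\<exists>x. S \<subseteq> {x}))"

definition profinite_group :: "('g, 'c) tgroup_scheme \<Rightarrow> bool" where
  "profinite_group G \<longleftrightarrow>
     Group.group G \<and> topspace (gtop G) = carrier G \<and> profinite_space (gtop G) \<and>
     continuous_map (prod_topology (gtop G) (gtop G)) (gtop G) (\<lambda>(x, y). x \<otimes>\<^bsub>G\<^esub> y) \<and>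
     continuous_map (gtop G) (gtop G) (\<lambda>x. inv\<^bsub>G\<^esub> x)"

definition profinite_cring :: "('r, 'c) tring_scheme \<Rightarrow> bool" where
  "profinite_cring R \<longleftrightarrow>
     cring R \<and> topspace (rtop R) = carrier R \<and> profinite_space (rtop R) \<and>
     continuous_map (prod_topology (rtop R) (rtop R)) (rtop R) (\<lambda>(x, y). x \<oplus>\<^bsub>R\<^esub> y) \<and>
     continuous_map (rtop R) (rtop R) (\<lambda>x. \<ominus>\<^bsub>R\<^esub> x) \<and>
     continuous_map (prod_topology (rtop R) (rtop R)) (rtop R) (\<lambda>(x, y). x \<otimes>\<^bsub>R\<^esub> y)"

text \<open>Compact (Hausdorff) modules over the completed group ring \<open>R[[G]]\<close>, given by the
  actions of \<open>R\<close> and of \<open>G\<close>: since \<open>R[G]\<close> is dense in \<open>R[[G]]\<close>, the module structure is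
  determined by these, and a compact topological \<open>R\<close>-module with a continuous \<open>R\<close>-linear action
  of \<open>G\<close> is an inverse limit of finite \<open>R[G]\<close>-modules with continuous actions, hence an
  \<open>R[[G]]\<close>-module.\<close>

definition compact_RG_module ::
  "('g, 'c) tgroup_scheme \<Rightarrow> ('r, 'd) tring_scheme \<Rightarrow> ('g, 'r, 't, 'e) rgmod_scheme \<Rightarrow> bool" where
  "compact_RG_module G R T \<longleftrightarrow>
     Module.module R T \<and> topspace (mtop T) = carrier T \<and>
     compact_space (mtop T) \<and> Hausdorff_space (mtop T) \<and>
     continuous_map (prod_topology (mtop T) (mtop T)) (mtop T) (\<lambda>(x, y). x \<oplus>\<^bsub>T\<^esub> y) \<and>
     continuous_map (mtop T) (mtop T) (\<lambda>x. \<ominus>\<^bsub>T\<^esub> x) \<and>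
     continuous_map (prod_topology (rtop R) (mtop T)) (mtop T) (\<lambda>(r, x). r \<odot>\<^bsub>T\<^esub> x) \<and>
     continuous_map (prod_topology (gtop G) (mtop T)) (mtop T) (\<lambda>(g, x). mact T g x) \<and>
     (\<forall>x\<in>carrier T. mact T \<one>\<^bsub>G\<^esub> x = x) \<and>
     (\<forall>g\<in>carrier G. \<forall>h\<in>carrier G. \<forall>x\<in>carrier T.
        mact T (g \<otimes>\<^bsub>G\<^esub> h) x = mact T g (mact T h x)) \<and>
     (\<forall>g\<in>carrier G. \<forall>x\<in>carrier T. \<forall>y\<in>carrier T.
        mact T g (x \<oplus>\<^bsub>T\<^esub> y) = mact T g x \<oplus>\<^bsub>T\<^esub> mact T g y) \<and>
     (\<forall>g\<in>carrier G. \<forall>r\<in>carrier R. \<forall>x\<in>carrier T.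
        mact T g (r \<odot>\<^bsub>T\<^esub> x) = r \<odot>\<^bsub>T\<^esub> mact T g x)"

definition fin_gen_module :: "('r, 'd) ring_scheme \<Rightarrow> ('r, 't, 'e) module_scheme \<Rightarrow> bool" where
  "fin_gen_module R T \<longleftrightarrow> (\<exists>S. finite S \<and> S \<subseteq> carrier T \<and>
     (\<forall>x\<in>carrier T. \<exists>c\<in>S \<rightarrow> carrier R. x = (\<Oplus>\<^bsub>T\<^esub>s\<in>S. c s \<odot>\<^bsub>T\<^esub> s)))"

definition gmod_of :: "('g, 'r, 't, 'e) rgmod_scheme \<Rightarrow> ('g, 't) gmod" where
  "gmod_of T = \<lparr>carrier = carrier T, monoid.mult = (\<oplus>\<^bsub>T\<^esub>), one = \<zero>\<^bsub>T\<^esub>,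
                gtop = mtop T, act = mact T\<rparr>"

text \<open>The quotient by a subgroup stable under the action: \<open>g\<close> sends a coset to its
  elementwise image, which is again a coset.\<close>

definition quot_gmod :: "('g, 'm, 'c) gmod_scheme \<Rightarrow> 'm set \<Rightarrow> ('g, 'm set) gmod" where
  "quot_gmod M N =
     \<lparr>carrier = carrier (M Mod N), monoid.mult = (\<otimes>\<^bsub>M Mod N\<^esub>), one = \<one>\<^bsub>M Mod N\<^esub>,
      gtop = topology (\<lambda>V. V \<subseteq> carrier (M Mod N) \<and>
                           openin (gtop M) {x \<in> topspace (gtop M). N #>\<^bsub>M\<^esub> x \<in> V}),
      act = (\<lambda>g Y. act M g ` Y)\<rparr>"

section \<open>Continuous cohomology in degrees one and two\<close>

text \<open>Cochains are extensional functions, so that equality of cochains is equality on \<open>G\<close>.\<close>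

definition C1 :: "('g, 'c) tgroup_scheme \<Rightarrow> ('g, 'm, 'd) gmod_scheme \<Rightarrow> ('g \<Rightarrow> 'm) set" where
  "C1 G M = {f \<in> carrier G \<rightarrow>\<^sub>E carrier M. continuous_map (gtop G) (gtop M) f}"

definition C2 :: "('g, 'c) tgroup_scheme \<Rightarrow> ('g, 'm, 'd) gmod_scheme \<Rightarrow> ('g \<times> 'g \<Rightarrow> 'm) set" where
  "C2 G M = {f \<in> carrier G \<times> carrier G \<rightarrow>\<^sub>E carrier M.
               continuous_map (prod_topology (gtop G) (gtop G)) (gtop M) f}"

definition d0 :: "('g, 'c) tgroup_scheme \<Rightarrow> ('g, 'm, 'd) gmod_scheme \<Rightarrow> 'm \<Rightarrow> 'g \<Rightarrow> 'm" where
  "d0 G M x = (\<lambda>g\<in>carrier G. act M g x \<otimes>\<^bsub>M\<^esub> inv\<^bsub>M\<^esub> x)"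

definition d1 :: "('g, 'c) tgroup_scheme \<Rightarrow> ('g, 'm, 'd) gmod_scheme \<Rightarrow> ('g \<Rightarrow> 'm) \<Rightarrow> 'g \<times> 'g \<Rightarrow> 'm" where
  "d1 G M f = (\<lambda>(g, h)\<in>carrier G \<times> carrier G.
     act M g (f h) \<otimes>\<^bsub>M\<^esub> inv\<^bsub>M\<^esub> f (g \<otimes>\<^bsub>G\<^esub> h) \<otimes>\<^bsub>M\<^esub> f g)"

definition d2 :: "('g, 'c) tgroup_scheme \<Rightarrow> ('g, 'm, 'd) gmod_scheme \<Rightarrow> ('g \<times> 'g \<Rightarrow> 'm) \<Rightarrow>
    'g \<times> 'g \<times> 'g \<Rightarrow> 'm" where
  "d2 G M f = (\<lambda>(g, h, k)\<in>carrier G \<times> carrier G \<times> carrier G.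
     act M g (f (h, k)) \<otimes>\<^bsub>M\<^esub> inv\<^bsub>M\<^esub> f (g \<otimes>\<^bsub>G\<^esub> h, k) \<otimes>\<^bsub>M\<^esub> f (g, h \<otimes>\<^bsub>G\<^esub> k)
       \<otimes>\<^bsub>M\<^esub> inv\<^bsub>M\<^esub> f (g, h))"

definition Z1 :: "('g, 'c) tgroup_scheme \<Rightarrow> ('g, 'm, 'd) gmod_scheme \<Rightarrow> ('g \<Rightarrow> 'm) monoid" where
  "Z1 G M = (product_group (carrier G) (\<lambda>_. M))
     \<lparr>carrier := {f \<in> C1 G M. \<forall>p\<in>carrier G \<times> carrier G. d1 G M f p = \<one>\<^bsub>M\<^esub>}\<rparr>"

definition Z2 :: "('g, 'c) tgroup_scheme \<Rightarrow> ('g, 'm, 'd) gmod_scheme \<Rightarrow> ('g \<times> 'g \<Rightarrow> 'm) monoid" where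
  "Z2 G M = (product_group (carrier G \<times> carrier G) (\<lambda>_. M))
     \<lparr>carrier := {f \<in> C2 G M. \<forall>p\<in>carrier G \<times> carrier G \<times> carrier G. d2 G M f p = \<one>\<^bsub>M\<^esub>}\<rparr>"

definition B1 :: "('g, 'c) tgroup_scheme \<Rightarrow> ('g, 'm, 'd) gmod_scheme \<Rightarrow> ('g \<Rightarrow> 'm) set" where
  "B1 G M = d0 G M ` carrier M"

definition B2 :: "('g, 'c) tgroup_scheme \<Rightarrow> ('g, 'm, 'd) gmod_scheme \<Rightarrow> ('g \<times> 'g \<Rightarrow> 'm) set" where
  "B2 G M = d1 G M ` C1 G M"

definition H1 :: "('g, 'c) tgroup_scheme \<Rightarrow> ('g, 'm, 'd) gmod_scheme \<Rightarrow> ('g \<Rightarrow> 'm) set monoid" where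
  "H1 G M = Z1 G M Mod B1 G M"

definition H2 :: "('g, 'c) tgroup_scheme \<Rightarrow> ('g, 'm, 'd) gmod_scheme \<Rightarrow> ('g \<times> 'g \<Rightarrow> 'm) set monoid" where
  "H2 G M = Z2 G M Mod B2 G M"

definition class1 :: "('g, 'c) tgroup_scheme \<Rightarrow> ('g, 'm, 'd) gmod_scheme \<Rightarrow> ('g \<Rightarrow> 'm) \<Rightarrow> ('g \<Rightarrow> 'm) set" where
  "class1 G M f = B1 G M #>\<^bsub>Z1 G M\<^esub> f"

definition class2 :: "('g, 'c) tgroup_scheme \<Rightarrow> ('g, 'm, 'd) gmod_scheme \<Rightarrow> ('g \<times> 'g \<Rightarrow> 'm) \<Rightarrow>
    ('g \<times> 'g \<Rightarrow> 'm) set" where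
  "class2 G M f = B2 G M #>\<^bsub>Z2 G M\<^esub> f"

text \<open>The connecting map \<open>H\<^sup>1(G,C) \<rightarrow> H\<^sup>2(G,A)\<close> of \<open>0 \<rightarrow> A \<rightarrow> B \<rightarrow> C \<rightarrow> 0\<close> (maps \<open>i\<close>, \<open>p\<close>): lift a
  representing cocycle to a continuous cochain \<open>b\<close> with values in \<open>B\<close>, and take the class of
  the cocycle \<open>z\<close> with \<open>i \<circ> z = d1 b\<close>.\<close>

definition connecting ::
  "('g, 'c) tgroup_scheme \<Rightarrow> ('g, 'm1, 'd1) gmod_scheme \<Rightarrow> ('g, 'm2, 'd2) gmod_scheme \<Rightarrow>
   ('g, 'm3, 'd3) gmod_scheme \<Rightarrow> ('m1 \<Rightarrow> 'm2) \<Rightarrow> ('m2 \<Rightarrow> 'm3) \<Rightarrow>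
   ('g \<Rightarrow> 'm3) set \<Rightarrow> ('g \<times> 'g \<Rightarrow> 'm1) set" where
  "connecting G A B C i p x = (THE y. y \<in> carrier (H2 G A) \<and>
     (\<exists>c\<in>x. \<exists>b\<in>C1 G B. \<exists>z\<in>carrier (Z2 G A).
        (\<forall>g\<in>carrier G. p (b g) = c g) \<and>
        (\<forall>q\<in>carrier G \<times> carrier G. i (z q) = d1 G B b q) \<and>
        y = class2 G A z))"

section \<open>Matrices\<close>

text \<open>An \<open>m \<times> n\<close> matrix is an extensional function on \<open>{1..m} \<times> {1..n}\<close>.\<close>

definition mat_idx :: "nat \<Rightarrow> nat \<Rightarrow> (nat \<times> nat) set" where
  "mat_idx m n = {1..m} \<times> {1..n}"

definition rmat_mult :: "('r, 'd) ring_scheme \<Rightarrow> nat \<Rightarrow> (nat \<times> nat \<Rightarrow> 'r) \<Rightarrow> (nat \<times> nat \<Rightarrow> 'r) \<Rightarrow>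
    nat \<times> nat \<Rightarrow> 'r" where
  "rmat_mult R k A B = (\<lambda>(i, j)\<in>mat_idx k k. \<Oplus>\<^bsub>R\<^esub>l\<in>{1..k}. A (i, l) \<otimes>\<^bsub>R\<^esub> B (l, j))"

definition rmat_one :: "('r, 'd) ring_scheme \<Rightarrow> nat \<Rightarrow> nat \<times> nat \<Rightarrow> 'r" where
  "rmat_one R k = (\<lambda>(i, j)\<in>mat_idx k k. if i = j then \<one>\<^bsub>R\<^esub> else \<zero>\<^bsub>R\<^esub>)"

text \<open>Products of matrices over \<open>R\<close> with \<open>m \<times> n\<close> matrices over \<open>T\<close>, from the left and
  from the right; \<open>R\<close> is commutative, so \<open>x r = r x\<close> for \<open>x\<close> in \<open>T\<close>.\<close>

definition mat_lmult :: "('r, 't, 'e) module_scheme \<Rightarrow> nat \<Rightarrow> nat \<Rightarrow> (nat \<times> nat \<Rightarrow> 'r) \<Rightarrow>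
    (nat \<times> nat \<Rightarrow> 't) \<Rightarrow> nat \<times> nat \<Rightarrow> 't" where
  "mat_lmult T m n P X = (\<lambda>(i, j)\<in>mat_idx m n. \<Oplus>\<^bsub>T\<^esub>l\<in>{1..m}. P (i, l) \<odot>\<^bsub>T\<^esub> X (l, j))"

definition mat_rmult :: "('r, 't, 'e) module_scheme \<Rightarrow> nat \<Rightarrow> nat \<Rightarrow> (nat \<times> nat \<Rightarrow> 't) \<Rightarrow>
    (nat \<times> nat \<Rightarrow> 'r) \<Rightarrow> nat \<times> nat \<Rightarrow> 't" where
  "mat_rmult T m n X Q = (\<lambda>(i, j)\<in>mat_idx m n. \<Oplus>\<^bsub>T\<^esub>l\<in>{1..n}. Q (l, j) \<odot>\<^bsub>T\<^esub> X (i, l))"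

definition mat_add :: "('t, 'e) ring_scheme \<Rightarrow> nat \<Rightarrow> nat \<Rightarrow> (nat \<times> nat \<Rightarrow> 't) \<Rightarrow>
    (nat \<times> nat \<Rightarrow> 't) \<Rightarrow> nat \<times> nat \<Rightarrow> 't" where
  "mat_add T m n X Y = (\<lambda>q\<in>mat_idx m n. X q \<oplus>\<^bsub>T\<^esub> Y q)"

definition mat_zero :: "('t, 'e) ring_scheme \<Rightarrow> nat \<Rightarrow> nat \<Rightarrow> nat \<times> nat \<Rightarrow> 't" where
  "mat_zero T m n = (\<lambda>q\<in>mat_idx m n. \<zero>\<^bsub>T\<^esub>)"

definition mat_act :: "('g, 'r, 't, 'e) rgmod_scheme \<Rightarrow> nat \<Rightarrow> nat \<Rightarrow> 'g \<Rightarrow> (nat \<times> nat \<Rightarrow> 't) \<Rightarrow>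
    nat \<times> nat \<Rightarrow> 't" where
  "mat_act T m n g X = (\<lambda>q\<in>mat_idx m n. mact T g (X q))"

definition mat_corner :: "('t, 'e) ring_scheme \<Rightarrow> nat \<Rightarrow> nat \<Rightarrow> 't \<Rightarrow> nat \<times> nat \<Rightarrow> 't" where
  "mat_corner T m n t = (\<lambda>q\<in>mat_idx m n. if q = (1, n) then t else \<zero>\<^bsub>T\<^esub>)"

definition unitri :: "('r, 'd) tring_scheme \<Rightarrow> nat \<Rightarrow> (nat \<times> nat \<Rightarrow> 'r) tgroup" where
  "unitri R k = (let U = {A \<in> mat_idx k k \<rightarrow>\<^sub>E carrier R.
                           (\<forall>i\<in>{1..k}. A (i, i) = \<one>\<^bsub>R\<^esub>) \<and>
                           (\<forall>i\<in>{1..k}. \<forall>j\<in>{1..k}. j < i \<longrightarrow> A (i, j) = \<zero>\<^bsub>R\<^esub>)} in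
     \<lparr>carrier = U, monoid.mult = rmat_mult R k, one = rmat_one R k,
      gtop = subtopology (product_topology (\<lambda>_. rtop R) (mat_idx k k)) U\<rparr>)"

definition partial_defining_system ::
  "('g, 'c) tgroup_scheme \<Rightarrow> ('r, 'd) tring_scheme \<Rightarrow> nat \<Rightarrow> nat \<Rightarrow>
   ('g \<Rightarrow> nat \<times> nat \<Rightarrow> 'r) \<Rightarrow> ('g \<Rightarrow> nat \<times> nat \<Rightarrow> 'r) \<Rightarrow> bool" where
  "partial_defining_system G R a b \<phi> \<theta> \<longleftrightarrow>
     \<phi> \<in> hom G (unitri R (a + 1)) \<and> continuous_map (gtop G) (gtop (unitri R (a + 1))) \<phi> \<and>
     \<theta> \<in> hom G (unitri R (b + 1)) \<and> continuous_map (gtop G) (gtop (unitri R (b + 1))) \<theta>"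

section \<open>The modules of matrices with twisted action\<close>

definition frakU ::
  "('r, 'd) tring_scheme \<Rightarrow> ('g, 'r, 't, 'e) rgmod_scheme \<Rightarrow> nat \<Rightarrow> nat \<Rightarrow>
   ('g \<Rightarrow> nat \<times> nat \<Rightarrow> 'r) \<Rightarrow> ('g \<Rightarrow> nat \<times> nat \<Rightarrow> 'r) \<Rightarrow> ('g, nat \<times> nat \<Rightarrow> 't) gmod" where
  "frakU R T a b \<phi> \<theta> =
     \<lparr>carrier = mat_idx (a + 1) (b + 1) \<rightarrow>\<^sub>E carrier T,
      monoid.mult = mat_add T (a + 1) (b + 1),
      one = mat_zero T (a + 1) (b + 1),
      gtop = product_topology (\<lambda>_. mtop T) (mat_idx (a + 1) (b + 1)),
      act = (\<lambda>g X. mat_rmult T (a + 1) (b + 1)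
                     (mat_lmult T (a + 1) (b + 1) (\<phi> g) (mat_act T (a + 1) (b + 1) g X))
                     (inv\<^bsub>unitri R (b + 1)\<^esub> (\<theta> g)))\<rparr>"

definition frakU_incl :: "('t, 'e) ring_scheme \<Rightarrow> nat \<Rightarrow> nat \<Rightarrow> 't \<Rightarrow> nat \<times> nat \<Rightarrow> 't" where
  "frakU_incl T a b = mat_corner T (a + 1) (b + 1)"

definition frakU' ::
  "('r, 'd) tring_scheme \<Rightarrow> ('g, 'r, 't, 'e) rgmod_scheme \<Rightarrow> nat \<Rightarrow> nat \<Rightarrow>
   ('g \<Rightarrow> nat \<times> nat \<Rightarrow> 'r) \<Rightarrow> ('g \<Rightarrow> nat \<times> nat \<Rightarrow> 'r) \<Rightarrow> ('g, (nat \<times> nat \<Rightarrow> 't) set) gmod" where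
  "frakU' R T a b \<phi> \<theta> = quot_gmod (frakU R T a b \<phi> \<theta>) (frakU_incl T a b ` carrier T)"

definition frakU_proj ::
  "('r, 'd) tring_scheme \<Rightarrow> ('g, 'r, 't, 'e) rgmod_scheme \<Rightarrow> nat \<Rightarrow> nat \<Rightarrow>
   ('g \<Rightarrow> nat \<times> nat \<Rightarrow> 'r) \<Rightarrow> ('g \<Rightarrow> nat \<times> nat \<Rightarrow> 'r) \<Rightarrow> (nat \<times> nat \<Rightarrow> 't) \<Rightarrow> (nat \<times> nat \<Rightarrow> 't) set" where
  "frakU_proj R T a b \<phi> \<theta> X = (frakU_incl T a b ` carrier T) #>\<^bsub>frakU R T a b \<phi> \<theta>\<^esub> X"

text \<open>The common value of an entry (other than the upper right one) on a class modulo \<open>T\<close>.\<close>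

definition quot_entry :: "(nat \<times> nat \<Rightarrow> 't) set \<Rightarrow> nat \<Rightarrow> nat \<Rightarrow> 't" where
  "quot_entry Y i j = the_elem ((\<lambda>X. X (i, j)) ` Y)"

section \<open>Block matrices, proper defining systems and Massey products\<close>

text \<open>The triple \<open>(P, X, Q)\<close> stands for the matrix of size \<open>a + b + 2\<close> with diagonal blocks
  \<open>P\<close>, \<open>Q\<close>, upper right block \<open>X\<close> and lower left block zero.\<close>

type_synonym ('r, 't) block = "(nat \<times> nat \<Rightarrow> 'r) \<times> (nat \<times> nat \<Rightarrow> 't) \<times> (nat \<times> nat \<Rightarrow> 'r)"

definition calU ::
  "('r, 'd) tring_scheme \<Rightarrow> ('g, 'r, 't, 'e) rgmod_scheme \<Rightarrow> nat \<Rightarrow> nat \<Rightarrow>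
   ('g, ('r, 't) block) gmod" where
  "calU R T a b =
     \<lparr>carrier = carrier (unitri R (a + 1)) \<times> (mat_idx (a + 1) (b + 1) \<rightarrow>\<^sub>E carrier T) \<times>
                carrier (unitri R (b + 1)),
      monoid.mult = (\<lambda>(P, X, Q) (P', X', Q').
        (rmat_mult R (a + 1) P P',
         mat_add T (a + 1) (b + 1) (mat_lmult T (a + 1) (b + 1) P X')
                                   (mat_rmult T (a + 1) (b + 1) X Q'),
         rmat_mult R (b + 1) Q Q')),
      one = (rmat_one R (a + 1), mat_zero T (a + 1) (b + 1), rmat_one R (b + 1)),
      gtop = prod_topology (gtop (unitri R (a + 1)))
               (prod_topology (product_topology (\<lambda>_. mtop T) (mat_idx (a + 1) (b + 1)))
                              (gtop (unitri R (b + 1)))),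
      act = (\<lambda>g (P, X, Q). (P, mat_act T (a + 1) (b + 1) g X, Q))\<rparr>"

definition calU_centre ::
  "('r, 'd) tring_scheme \<Rightarrow> ('g, 'r, 't, 'e) rgmod_scheme \<Rightarrow> nat \<Rightarrow> nat \<Rightarrow> ('r, 't) block set" where
  "calU_centre R T a b =
     {rmat_one R (a + 1)} \<times> (mat_corner T (a + 1) (b + 1) ` carrier T) \<times> {rmat_one R (b + 1)}"

definition calU' ::
  "('r, 'd) tring_scheme \<Rightarrow> ('g, 'r, 't, 'e) rgmod_scheme \<Rightarrow> nat \<Rightarrow> nat \<Rightarrow>
   ('g, ('r, 't) block set) gmod" where
  "calU' R T a b = quot_gmod (calU R T a b) (calU_centre R T a b)"

text \<open>The element of \<open>calU'\<close> with diagonal blocks \<open>P\<close>, \<open>Q\<close> and upper right block the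
  class \<open>Y\<close> of matrices modulo \<open>T\<close>; as a coset it consists of all \<open>(P, X, Q)\<close> with \<open>X \<in> Y\<close>.\<close>

definition block' ::
  "(nat \<times> nat \<Rightarrow> 'r) \<Rightarrow> (nat \<times> nat \<Rightarrow> 't) set \<Rightarrow> (nat \<times> nat \<Rightarrow> 'r) \<Rightarrow> ('r, 't) block set" where
  "block' P Y Q = {P} \<times> Y \<times> {Q}"

text \<open>As a group, \<open>frakU'\<close> is the group of matrices modulo \<open>T\<close> for every \<open>\<phi>\<close>, \<open>\<theta>\<close>.\<close>

definition proper_defining_system ::
  "('g, 'c) tgroup_scheme \<Rightarrow> ('r, 'd) tring_scheme \<Rightarrow> ('g, 'r, 't, 'e) rgmod_scheme \<Rightarrow> nat \<Rightarrow> nat \<Rightarrow>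
   ('g \<Rightarrow> nat \<times> nat \<Rightarrow> 'r) \<Rightarrow> ('g \<Rightarrow> nat \<times> nat \<Rightarrow> 'r) \<Rightarrow> ('g \<Rightarrow> ('r, 't) block set) \<Rightarrow> bool" where
  "proper_defining_system G R T a b \<phi> \<theta> \<rho> \<longleftrightarrow>
     \<rho> \<in> carrier G \<rightarrow> carrier (calU' R T a b) \<and>
     continuous_map (gtop G) (gtop (calU' R T a b)) \<rho> \<and>
     (\<forall>g\<in>carrier G. \<forall>h\<in>carrier G.
        \<rho> (g \<otimes>\<^bsub>G\<^esub> h) = \<rho> g \<otimes>\<^bsub>calU' R T a b\<^esub> act (calU' R T a b) g (\<rho> h)) \<and>
     (\<exists>\<kappa>\<in>carrier G \<rightarrow> carrier (frakU' R T a b \<phi> \<theta>).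
        \<forall>g\<in>carrier G. \<rho> g = block' (\<phi> g) (\<kappa> g) (\<theta> g))"

definition calU_lift :: "('t, 'e) ring_scheme \<Rightarrow> nat \<Rightarrow> ('r, 't) block set \<Rightarrow> ('r, 't) block" where
  "calU_lift T b C = (THE A. A \<in> C \<and> fst (snd A) (1, b + 1) = \<zero>\<^bsub>T\<^esub>)"

text \<open>With \<open>n = a + b\<close>, the sum over \<open>i = 2, \<dots>, n + 1\<close> of the products of the \<open>(1, i)\<close>- and
  \<open>(i, n + 2)\<close>-entries of the lifts splits according to the block of the entries: for
  \<open>i \<le> a + 1\<close> they are \<open>P (1, i)\<close> and \<open>X (i, b + 1)\<close>, and for \<open>i = a + 1 + l\<close> they are \<open>X (1, l)\<close>
  and \<open>Q (l, b + 1)\<close>, where \<open>G\<close> fixes the entries of \<open>Q\<close>.\<close>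

definition massey_cocycle ::
  "('g, 'c) tgroup_scheme \<Rightarrow> ('g, 'r, 't, 'e) rgmod_scheme \<Rightarrow> nat \<Rightarrow> nat \<Rightarrow>
   ('g \<Rightarrow> ('r, 't) block set) \<Rightarrow> 'g \<times> 'g \<Rightarrow> 't" where
  "massey_cocycle G T a b \<rho> = (\<lambda>(g, h)\<in>carrier G \<times> carrier G.
     case calU_lift T b (\<rho> g) of (P, X, Q) \<Rightarrow> case calU_lift T b (\<rho> h) of (P', X', Q') \<Rightarrow>
       (\<Oplus>\<^bsub>T\<^esub>i\<in>{2..a + 1}. P (1, i) \<odot>\<^bsub>T\<^esub> mact T g (X' (i, b + 1))) \<oplus>\<^bsub>T\<^esub>
       (\<Oplus>\<^bsub>T\<^esub>l\<in>{1..b}. Q' (l, b + 1) \<odot>\<^bsub>T\<^esub> X (1, l)))"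

definition massey_product ::
  "('g, 'c) tgroup_scheme \<Rightarrow> ('g, 'r, 't, 'e) rgmod_scheme \<Rightarrow> nat \<Rightarrow> nat \<Rightarrow>
   ('g \<Rightarrow> ('r, 't) block set) \<Rightarrow> ('g \<times> 'g \<Rightarrow> 't) set" where
  "massey_product G T a b \<rho> = class2 G (gmod_of T) (massey_cocycle G T a b \<rho>)"

text \<open>The Massey product \<open>(\<alpha>\<^sub>1, \<dots>, \<alpha>\<^sub>a, \<lambda>, \<beta>\<^sub>1, \<dots>, \<beta>\<^sub>b)\<^sub>\<rho>\<close> depends on \<open>\<rho>\<close> only; the maps listed are
  the entries of \<open>\<rho>\<close> just above the diagonal, which is what the following predicate says.\<close>

definition massey_arguments ::
  "('g, 'c) tgroup_scheme \<Rightarrow> ('t, 'e) ring_scheme \<Rightarrow> nat \<Rightarrow> nat \<Rightarrow> ('g \<Rightarrow> ('r, 't) block set) \<Rightarrow>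
   (nat \<Rightarrow> 'g \<Rightarrow> 'r) \<Rightarrow> ('g \<Rightarrow> 't) \<Rightarrow> (nat \<Rightarrow> 'g \<Rightarrow> 'r) \<Rightarrow> bool" where
  "massey_arguments G T a b \<rho> \<alpha> lam \<beta> \<longleftrightarrow>
     (\<forall>g\<in>carrier G. case calU_lift T b (\<rho> g) of (P, X, Q) \<Rightarrow>
        (\<forall>i\<in>{1..a}. P (i, i + 1) = \<alpha> i g) \<and>
        X (a + 1, 1) = lam g \<and>
        (\<forall>i\<in>{1..b}. Q (i, i + 1) = \<beta> i g))"

end

theory Submission
  imports Defs "HOL-Algebra.AbelCoset"
begin

text \<open>
  Let \<open>X\<close> be the upper right block of the lift of \<open>\<rho>\<close>, so that \<open>X\<close> has upper right entry zero and
  \<open>\<kappa> = X \<theta>\<^sup>-\<^sup>1\<close> is a continuous lift of \<open>\<kappa>'\<close> to matrices over \<open>T\<close>. Multiplying the coboundary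
  \<open>g \<star> \<kappa>(h) - \<kappa>(gh) + \<kappa>(g)\<close> on the right by \<open>\<theta>(gh)\<close> gives \<open>\<phi>(g) gX(h) + X(g) \<theta>(h) - X(gh)\<close>.
  Since \<open>\<kappa>'\<close> is a cocycle, the coboundary is concentrated in the upper right entry, where
  multiplication by a unitriangular matrix does nothing; as \<open>X(gh)\<close> vanishes there, the entry is that
  of \<open>\<phi>(g) gX(h) + X(g) \<theta>(h)\<close>, which is the Massey cocycle. The connecting map may be computed with
  any continuous lift because taking the upper right entry is a continuous retraction of the matrices
  onto \<open>T\<close>.
\<close>

section \<open>Continuous cochains and the connecting map\<close>

lemma continuous_map_uncurried:
  assumes "continuous_map (prod_topology Y Z) W (\<lambda>(y, z). h y z)"
    and "continuous_map X Y f" "continuous_map X Z g"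
  shows "continuous_map X W (\<lambda>x. h (f x) (g x))"
  using continuous_map_compose[OF continuous_map_pairedI[OF assms(2,3)] assms(1)] by (simp add: o_def)

lemma comm_group_cong:
  assumes "comm_group H" and "carrier K = carrier H" "mult K = mult H" "one K = one H"
  shows "comm_group K"
proof -
  interpret comm_group H by fact
  show ?thesis
    by (rule comm_groupI) (auto simp: assms m_ac intro: l_inv_ex)
qed

lemma comm_group_product_group:
  assumes "\<And>i. i \<in> I \<Longrightarrow> comm_group (G i)"
  shows "comm_group (product_group I G)"
proof (rule group.group_comm_groupI)
  show "group (product_group I G)"
    using assms by (simp add: comm_group_def)
  show "f \<otimes>\<^bsub>product_group I G\<^esub> g = g \<otimes>\<^bsub>product_group I G\<^esub> f"
    if "f \<in> carrier (product_group I G)" "g \<in> carrier (product_group I G)" for f g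
    using that assms by (auto simp: PiE_iff comm_group_def intro!: restrict_ext comm_monoid.m_comm)
qed

locale topological_gmodule = G: group G + M: comm_group M
  for G :: "('g, 'c) tgroup_scheme" (structure) and M :: "('g, 'm, 'd) gmod_scheme" +
  assumes topspace_G: "topspace (gtop G) = carrier G"
    and continuous_mult_G: "continuous_map (prod_topology (gtop G) (gtop G)) (gtop G) (\<lambda>(x, y). x \<otimes>\<^bsub>G\<^esub> y)"
    and topspace_M: "topspace (gtop M) = carrier M"
    and continuous_mult_M: "continuous_map (prod_topology (gtop M) (gtop M)) (gtop M) (\<lambda>(x, y). x \<otimes>\<^bsub>M\<^esub> y)"
    and continuous_inv_M: "continuous_map (gtop M) (gtop M) (\<lambda>x. inv\<^bsub>M\<^esub> x)"
    and continuous_act_M: "continuous_map (prod_topology (gtop G) (gtop M)) (gtop M) (\<lambda>(g, x). act M g x)"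
    and act_one: "x \<in> carrier M \<Longrightarrow> act M \<one>\<^bsub>G\<^esub> x = x"
    and act_act: "\<lbrakk>g \<in> carrier G; h \<in> carrier G; x \<in> carrier M\<rbrakk> \<Longrightarrow>
      act M (g \<otimes>\<^bsub>G\<^esub> h) x = act M g (act M h x)"
    and act_mult: "\<lbrakk>g \<in> carrier G; x \<in> carrier M; y \<in> carrier M\<rbrakk> \<Longrightarrow>
      act M g (x \<otimes>\<^bsub>M\<^esub> y) = act M g x \<otimes>\<^bsub>M\<^esub> act M g y"
begin

lemmas continuous_mult = continuous_map_uncurried[OF continuous_mult_M]
  and continuous_act = continuous_map_uncurried[OF continuous_act_M]

lemma continuous_inv: "continuous_map X (gtop M) f \<Longrightarrow> continuous_map X (gtop M) (\<lambda>x. inv\<^bsub>M\<^esub> f x)"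
  using continuous_map_compose[OF _ continuous_inv_M] by (simp add: o_def)

lemma continuous_closed:
  "\<lbrakk>continuous_map X (gtop M) f; x \<in> topspace X\<rbrakk> \<Longrightarrow> f x \<in> carrier M"
  using continuous_map_image_subset_topspace[of X "gtop M" f] by (auto simp: topspace_M)

lemma act_closed [simp]: "\<lbrakk>g \<in> carrier G; x \<in> carrier M\<rbrakk> \<Longrightarrow> act M g x \<in> carrier M"
  using continuous_closed[OF continuous_act_M] by (auto simp: topspace_G topspace_M)

lemma act_group_hom: "g \<in> carrier G \<Longrightarrow> group_hom M M (act M g)"
  by unfold_locales (auto simp: hom_def act_mult)

lemma act_inv: "\<lbrakk>g \<in> carrier G; x \<in> carrier M\<rbrakk> \<Longrightarrow> act M g (inv\<^bsub>M\<^esub> x) = inv\<^bsub>M\<^esub> act M g x"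
  using act_group_hom group_hom.hom_inv by metis

lemma act_id: "g \<in> carrier G \<Longrightarrow> act M g \<one>\<^bsub>M\<^esub> = \<one>\<^bsub>M\<^esub>"
  using act_group_hom group_hom.hom_one by metis

lemma C1_closed: "\<lbrakk>f \<in> C1 G M; g \<in> carrier G\<rbrakk> \<Longrightarrow> f g \<in> carrier M"
  by (auto simp: C1_def)

lemma C1_funcset: "f \<in> C1 G M \<Longrightarrow> f \<in> carrier G \<rightarrow> carrier M"
  by (auto simp: C1_def)

lemma C1_continuous: "f \<in> C1 G M \<Longrightarrow> continuous_map (gtop G) (gtop M) f"
  by (auto simp: C1_def)

lemma C1_restrictI:
  assumes "continuous_map (gtop G) (gtop M) f"
  shows "(\<lambda>g\<in>carrier G. f g) \<in> C1 G M"
proof -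
  have "continuous_map (gtop G) (gtop M) (\<lambda>g\<in>carrier G. f g)"
    by (rule continuous_map_eq[OF assms]) (simp add: topspace_G)
  then show ?thesis
    using continuous_closed[OF assms] by (simp add: C1_def topspace_G)
qed

lemma C2_restrictI:
  assumes "continuous_map (prod_topology (gtop G) (gtop G)) (gtop M) f"
  shows "(\<lambda>q\<in>carrier G \<times> carrier G. f q) \<in> C2 G M"
proof -
  have "continuous_map (prod_topology (gtop G) (gtop G)) (gtop M) (\<lambda>q\<in>carrier G \<times> carrier G. f q)"
    by (rule continuous_map_eq[OF assms]) (simp add: topspace_G)
  then show ?thesis
    using continuous_closed[OF assms] by (simp add: C2_def topspace_G)
qed

lemma C1_mult: "\<lbrakk>f \<in> C1 G M; f' \<in> C1 G M\<rbrakk> \<Longrightarrow> (\<lambda>g\<in>carrier G. f g \<otimes>\<^bsub>M\<^esub> f' g) \<in> C1 G M"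
  by (intro C1_restrictI continuous_mult C1_continuous)

lemma C1_inv: "f \<in> C1 G M \<Longrightarrow> (\<lambda>g\<in>carrier G. inv\<^bsub>M\<^esub> f g) \<in> C1 G M"
  by (intro C1_restrictI continuous_inv C1_continuous)

lemma d0_C1: "x \<in> carrier M \<Longrightarrow> d0 G M x \<in> C1 G M"
  unfolding d0_def
  by (intro C1_restrictI continuous_mult continuous_act) (auto simp: topspace_M)

lemma d1_apply: "\<lbrakk>g \<in> carrier G; h \<in> carrier G\<rbrakk> \<Longrightarrow>
    d1 G M f (g, h) = act M g (f h) \<otimes>\<^bsub>M\<^esub> inv\<^bsub>M\<^esub> f (g \<otimes> h) \<otimes>\<^bsub>M\<^esub> f g"
  by (simp add: d1_def)

lemma d1_mult_cancel:
  assumes "f \<in> carrier G \<rightarrow> carrier M" "g \<in> carrier G" "h \<in> carrier G"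
  shows "d1 G M f (g, h) \<otimes>\<^bsub>M\<^esub> f (g \<otimes> h) = act M g (f h) \<otimes>\<^bsub>M\<^esub> f g"
proof -
  have closed: "act M g (f h) \<in> carrier M" "f (g \<otimes> h) \<in> carrier M" "f g \<in> carrier M"
    using assms by (simp_all add: Pi_iff)
  then have "d1 G M f (g, h) \<otimes>\<^bsub>M\<^esub> f (g \<otimes> h) =
      act M g (f h) \<otimes>\<^bsub>M\<^esub> f g \<otimes>\<^bsub>M\<^esub> (inv\<^bsub>M\<^esub> f (g \<otimes> h) \<otimes>\<^bsub>M\<^esub> f (g \<otimes> h))"
    using assms(2,3) by (simp only: d1_apply M.m_ac M.m_closed M.inv_closed)
  then show ?thesis
    using closed by simp
qed

lemma d1_extensional: "d1 G M f \<in> extensional (carrier G \<times> carrier G)"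
  by (simp add: d1_def)

lemma d1_closed:
  assumes "f \<in> carrier G \<rightarrow> carrier M" "q \<in> carrier G \<times> carrier G"
  shows "d1 G M f q \<in> carrier M"
  using assms by (auto simp: d1_apply Pi_iff)

lemma d1_C2:
  assumes "f \<in> C1 G M"
  shows "d1 G M f \<in> C2 G M"
proof -
  let ?X = "prod_topology (gtop G) (gtop G)"
  have f: "continuous_map ?X (gtop M) (\<lambda>q. f (u q))" if "continuous_map ?X (gtop G) u" for u
    using continuous_map_compose[OF that C1_continuous[OF assms]] by (simp add: o_def)
  have "continuous_map ?X (gtop M)
      (\<lambda>q. act M (fst q) (f (snd q)) \<otimes>\<^bsub>M\<^esub> inv\<^bsub>M\<^esub> f (fst q \<otimes> snd q) \<otimes>\<^bsub>M\<^esub> f (fst q))"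
    by (intro continuous_mult continuous_inv continuous_act f continuous_map_fst continuous_map_snd
        continuous_map_uncurried[OF continuous_mult_G])
  from C2_restrictI[OF this] show ?thesis
    by (simp add: d1_def case_prod_unfold)
qed

lemma d1_mult:
  assumes "f \<in> carrier G \<rightarrow> carrier M" "f' \<in> carrier G \<rightarrow> carrier M"
  shows "d1 G M (\<lambda>g\<in>carrier G. f g \<otimes>\<^bsub>M\<^esub> f' g) =
    (\<lambda>q\<in>carrier G \<times> carrier G. d1 G M f q \<otimes>\<^bsub>M\<^esub> d1 G M f' q)"
proof (rule extensionalityI[OF d1_extensional restrict_extensional])
  show "d1 G M (\<lambda>g\<in>carrier G. f g \<otimes>\<^bsub>M\<^esub> f' g) q =
      (\<lambda>q\<in>carrier G \<times> carrier G. d1 G M f q \<otimes>\<^bsub>M\<^esub> d1 G M f' q) q"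
    if "q \<in> carrier G \<times> carrier G" for q
    using that assms by (auto simp: d1_apply Pi_iff act_mult M.inv_mult M.m_ac)
qed

lemma d1_inv:
  assumes "f \<in> carrier G \<rightarrow> carrier M"
  shows "d1 G M (\<lambda>g\<in>carrier G. inv\<^bsub>M\<^esub> f g) = (\<lambda>q\<in>carrier G \<times> carrier G. inv\<^bsub>M\<^esub> d1 G M f q)"
proof (rule extensionalityI[OF d1_extensional restrict_extensional])
  show "d1 G M (\<lambda>g\<in>carrier G. inv\<^bsub>M\<^esub> f g) q =
      (\<lambda>q\<in>carrier G \<times> carrier G. inv\<^bsub>M\<^esub> d1 G M f q) q"
    if "q \<in> carrier G \<times> carrier G" for q
    using that assms by (auto simp: d1_apply Pi_iff act_inv M.inv_mult M.m_ac)
qed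

lemma d1_d0:
  assumes x: "x \<in> carrier M" and "q \<in> carrier G \<times> carrier G"
  shows "d1 G M (d0 G M x) q = \<one>\<^bsub>M\<^esub>"
proof -
  obtain g h where q: "q = (g, h)" and gh: "g \<in> carrier G" "h \<in> carrier G"
    using assms(2) by auto
  define y z where "y = act M g x" and "z = act M g (act M h x)"
  have yz: "y \<in> carrier M" "z \<in> carrier M"
    using x gh by (auto simp: y_def z_def)
  have "d1 G M (d0 G M x) q = (z \<otimes>\<^bsub>M\<^esub> inv\<^bsub>M\<^esub> y) \<otimes>\<^bsub>M\<^esub> inv\<^bsub>M\<^esub> (z \<otimes>\<^bsub>M\<^esub> inv\<^bsub>M\<^esub> x) \<otimes>\<^bsub>M\<^esub> (y \<otimes>\<^bsub>M\<^esub> inv\<^bsub>M\<^esub> x)"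
    using x gh by (simp add: q d1_apply d0_def act_mult act_inv act_act y_def z_def)
  also have "\<dots> = (z \<otimes>\<^bsub>M\<^esub> inv\<^bsub>M\<^esub> z) \<otimes>\<^bsub>M\<^esub> (y \<otimes>\<^bsub>M\<^esub> inv\<^bsub>M\<^esub> y) \<otimes>\<^bsub>M\<^esub> (x \<otimes>\<^bsub>M\<^esub> inv\<^bsub>M\<^esub> x)"
    using x yz by (simp only: M.inv_mult M.inv_inv M.m_ac M.inv_closed M.m_closed)
  finally show ?thesis
    using x yz by simp
qed

lemma d2_d1:
  assumes "f \<in> carrier G \<rightarrow> carrier M" "q \<in> carrier G \<times> carrier G \<times> carrier G"
  shows "d2 G M (d1 G M f) q = \<one>\<^bsub>M\<^esub>"
proof -
  obtain g h k where q: "q = (g, h, k)" and ghk: "g \<in> carrier G" "h \<in> carrier G" "k \<in> carrier G"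
    using assms(2) by auto
  have f: "\<And>x. x \<in> carrier G \<Longrightarrow> f x \<in> carrier M"
    using assms(1) by auto
  define x y z u v w where "x = act M g (act M h (f k))" and "y = act M g (f (h \<otimes> k))"
    and "z = act M g (f h)" and "u = f (g \<otimes> h \<otimes> k)" and "v = f (g \<otimes> h)" and "w = f g"
  have closed: "x \<in> carrier M" "y \<in> carrier M" "z \<in> carrier M" "u \<in> carrier M"
    "v \<in> carrier M" "w \<in> carrier M"
    using ghk f by (auto simp: x_def y_def z_def u_def v_def w_def)
  have "d2 G M (d1 G M f) q = (x \<otimes>\<^bsub>M\<^esub> inv\<^bsub>M\<^esub> y \<otimes>\<^bsub>M\<^esub> z) \<otimes>\<^bsub>M\<^esub> inv\<^bsub>M\<^esub> (x \<otimes>\<^bsub>M\<^esub> inv\<^bsub>M\<^esub> u \<otimes>\<^bsub>M\<^esub> v)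
      \<otimes>\<^bsub>M\<^esub> (y \<otimes>\<^bsub>M\<^esub> inv\<^bsub>M\<^esub> u \<otimes>\<^bsub>M\<^esub> w) \<otimes>\<^bsub>M\<^esub> inv\<^bsub>M\<^esub> (z \<otimes>\<^bsub>M\<^esub> inv\<^bsub>M\<^esub> v \<otimes>\<^bsub>M\<^esub> w)"
    using ghk f by (simp add: q d2_def d1_apply act_mult act_inv act_act G.m_assoc
        x_def y_def z_def u_def v_def w_def)
  also have "\<dots> = (x \<otimes>\<^bsub>M\<^esub> inv\<^bsub>M\<^esub> x) \<otimes>\<^bsub>M\<^esub> (y \<otimes>\<^bsub>M\<^esub> inv\<^bsub>M\<^esub> y) \<otimes>\<^bsub>M\<^esub> (z \<otimes>\<^bsub>M\<^esub> inv\<^bsub>M\<^esub> z)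
      \<otimes>\<^bsub>M\<^esub> (u \<otimes>\<^bsub>M\<^esub> inv\<^bsub>M\<^esub> u) \<otimes>\<^bsub>M\<^esub> (v \<otimes>\<^bsub>M\<^esub> inv\<^bsub>M\<^esub> v) \<otimes>\<^bsub>M\<^esub> (w \<otimes>\<^bsub>M\<^esub> inv\<^bsub>M\<^esub> w)"
    using closed by (simp only: M.inv_mult M.inv_inv M.m_ac M.inv_closed M.m_closed)
  finally show ?thesis
    using closed by simp
qed

subsection \<open>Degree two cocycles modulo coboundaries\<close>

lemma carrier_Z2: "carrier (Z2 G M) =
    {f \<in> C2 G M. \<forall>q\<in>carrier G \<times> carrier G \<times> carrier G. d2 G M f q = \<one>\<^bsub>M\<^esub>}"
  by (simp add: Z2_def)

lemma mult_Z2: "f \<otimes>\<^bsub>Z2 G M\<^esub> f' = (\<lambda>q\<in>carrier G \<times> carrier G. f q \<otimes>\<^bsub>M\<^esub> f' q)"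
  by (simp add: Z2_def)

lemma one_Z2: "\<one>\<^bsub>Z2 G M\<^esub> = (\<lambda>q\<in>carrier G \<times> carrier G. \<one>\<^bsub>M\<^esub>)"
  by (simp add: Z2_def)

lemma Z2_closed: "\<lbrakk>f \<in> carrier (Z2 G M); q \<in> carrier G \<times> carrier G\<rbrakk> \<Longrightarrow> f q \<in> carrier M"
  by (auto simp: carrier_Z2 C2_def)

lemma Z2_extensional: "f \<in> carrier (Z2 G M) \<Longrightarrow> f \<in> extensional (carrier G \<times> carrier G)"
  by (auto simp: carrier_Z2 C2_def PiE_def)

lemma Z2_continuous:
  "f \<in> carrier (Z2 G M) \<Longrightarrow> continuous_map (prod_topology (gtop G) (gtop G)) (gtop M) f"
  by (simp add: carrier_Z2 C2_def)

lemma Z2_mult: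
  assumes f: "f \<in> carrier (Z2 G M)" and f': "f' \<in> carrier (Z2 G M)"
  shows "f \<otimes>\<^bsub>Z2 G M\<^esub> f' \<in> carrier (Z2 G M)"
proof -
  have "d2 G M (f \<otimes>\<^bsub>Z2 G M\<^esub> f') q = d2 G M f q \<otimes>\<^bsub>M\<^esub> d2 G M f' q"
    if "q \<in> carrier G \<times> carrier G \<times> carrier G" for q
    using that Z2_closed[OF f] Z2_closed[OF f']
    by (auto simp: d2_def mult_Z2 act_mult M.inv_mult M.m_ac)
  moreover have "f \<otimes>\<^bsub>Z2 G M\<^esub> f' \<in> C2 G M"
    unfolding mult_Z2 using f f' by (intro C2_restrictI continuous_mult Z2_continuous)
  ultimately show ?thesis
    using f f' by (simp add: carrier_Z2)
qed

lemma Z2_inv: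
  assumes f: "f \<in> carrier (Z2 G M)"
  shows "(\<lambda>q\<in>carrier G \<times> carrier G. inv\<^bsub>M\<^esub> f q) \<in> carrier (Z2 G M)" (is "?f \<in> _")
proof -
  have "d2 G M ?f q = inv\<^bsub>M\<^esub> d2 G M f q" if "q \<in> carrier G \<times> carrier G \<times> carrier G" for q
    using that Z2_closed[OF f] by (auto simp: d2_def act_inv M.inv_mult M.m_ac)
  moreover have "?f \<in> C2 G M"
    using f by (intro C2_restrictI continuous_inv Z2_continuous)
  ultimately show ?thesis
    using f by (simp add: carrier_Z2)
qed

lemma subgroup_Z2: "subgroup (carrier (Z2 G M)) (product_group (carrier G \<times> carrier G) (\<lambda>_. M))"
proof (rule group.subgroupI)
  let ?P = "product_group (carrier G \<times> carrier G) (\<lambda>_. M)"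
  show "group ?P"
    by simp
  show sub: "carrier (Z2 G M) \<subseteq> carrier ?P"
    by (auto simp: carrier_Z2 C2_def)
  have "\<one>\<^bsub>?P\<^esub> \<in> carrier (Z2 G M)"
    by (auto simp: carrier_Z2 d2_def act_id topspace_M intro!: C2_restrictI)
  then show "carrier (Z2 G M) \<noteq> {}"
    by blast
  show "f \<otimes>\<^bsub>?P\<^esub> f' \<in> carrier (Z2 G M)" if "f \<in> carrier (Z2 G M)" "f' \<in> carrier (Z2 G M)" for f f'
    using Z2_mult[OF that] by (simp add: mult_Z2)
  show "inv\<^bsub>?P\<^esub> f \<in> carrier (Z2 G M)" if "f \<in> carrier (Z2 G M)" for f
    using Z2_inv[OF that] that sub by auto
qed

lemma comm_group_Z2: "comm_group (Z2 G M)"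
proof (rule group.group_comm_groupI)
  have "group ((product_group (carrier G \<times> carrier G) (\<lambda>_. M))\<lparr>carrier := carrier (Z2 G M)\<rparr>)"
    using subgroup_Z2 by (rule group.subgroup_imp_group[rotated]) simp
  then show "group (Z2 G M)"
    by (simp add: Z2_def)
  show "f \<otimes>\<^bsub>Z2 G M\<^esub> f' = f' \<otimes>\<^bsub>Z2 G M\<^esub> f" if "f \<in> carrier (Z2 G M)" "f' \<in> carrier (Z2 G M)" for f f'
    unfolding mult_Z2 using that by (intro restrict_ext M.m_comm Z2_closed)
qed

lemma inv_Z2:
  assumes f: "f \<in> carrier (Z2 G M)"
  shows "inv\<^bsub>Z2 G M\<^esub> f = (\<lambda>q\<in>carrier G \<times> carrier G. inv\<^bsub>M\<^esub> f q)"
proof (rule group.inv_equality[OF comm_group.axioms(2)[OF comm_group_Z2] _ f Z2_inv[OF f]])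
  show "(\<lambda>q\<in>carrier G \<times> carrier G. inv\<^bsub>M\<^esub> f q) \<otimes>\<^bsub>Z2 G M\<^esub> f = \<one>\<^bsub>Z2 G M\<^esub>"
    unfolding mult_Z2 one_Z2 by (rule restrict_ext) (simp add: Z2_closed[OF f])
qed

lemma d1_in_B2: "w \<in> C1 G M \<Longrightarrow> d1 G M w \<in> B2 G M"
  by (simp add: B2_def)

lemma d1_in_Z2: "w \<in> C1 G M \<Longrightarrow> d1 G M w \<in> carrier (Z2 G M)"
  using d1_C2 d2_d1[OF C1_funcset] by (simp add: carrier_Z2)

lemma B2_E:
  assumes "f \<in> B2 G M"
  obtains w where "w \<in> C1 G M" "f = d1 G M w"
  using assms unfolding B2_def by (rule imageE)

lemma subgroup_B2: "subgroup (B2 G M) (Z2 G M)"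
proof (rule group.subgroupI)
  show "group (Z2 G M)"
    using comm_group_Z2 by (rule comm_group.axioms(2))
  show "B2 G M \<subseteq> carrier (Z2 G M)"
    using d1_in_Z2 by (auto simp: B2_def)
  show "B2 G M \<noteq> {}"
    using d0_C1[of "\<one>\<^bsub>M\<^esub>"] d1_in_B2 by auto
  show "f \<otimes>\<^bsub>Z2 G M\<^esub> f' \<in> B2 G M" if f: "f \<in> B2 G M" and f': "f' \<in> B2 G M" for f f'
  proof -
    obtain w where w: "w \<in> C1 G M" "f = d1 G M w"
      using f by (rule B2_E)
    obtain w' where w': "w' \<in> C1 G M" "f' = d1 G M w'"
      using f' by (rule B2_E)
    show ?thesis
      using d1_in_B2[OF C1_mult[OF w(1) w'(1)]]
      unfolding mult_Z2 w(2) w'(2) d1_mult[OF C1_funcset[OF w(1)] C1_funcset[OF w'(1)]] .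
  qed
  show "inv\<^bsub>Z2 G M\<^esub> f \<in> B2 G M" if f: "f \<in> B2 G M" for f
  proof -
    obtain w where w: "w \<in> C1 G M" "f = d1 G M w"
      using f by (rule B2_E)
    show ?thesis
      using d1_in_B2[OF C1_inv[OF w(1)]]
      unfolding w(2) inv_Z2[OF d1_in_Z2[OF w(1)]] d1_inv[OF C1_funcset[OF w(1)]] .
  qed
qed

lemma class2_eqI:
  assumes w: "w \<in> C1 G M" and z: "z \<in> carrier (Z2 G M)" and z': "z' \<in> carrier (Z2 G M)"
    and diff: "\<And>q. q \<in> carrier G \<times> carrier G \<Longrightarrow> z' q = d1 G M w q \<otimes>\<^bsub>M\<^esub> z q"
  shows "class2 G M z' = class2 G M z"
proof -
  interpret Z2: comm_group "Z2 G M"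
    by (rule comm_group_Z2)
  have "z' = d1 G M w \<otimes>\<^bsub>Z2 G M\<^esub> z"
    using Z2_extensional[OF z'] diff by (auto simp: mult_Z2 fun_eq_iff extensional_def)
  then have "z' \<in> B2 G M #>\<^bsub>Z2 G M\<^esub> z"
    using w by (auto simp: r_coset_def B2_def)
  from Z2.repr_independence[OF this z subgroup_B2] show ?thesis
    by (simp add: class2_def)
qed

end

lemma class1_eq:
  "class1 G C c = (\<lambda>y. \<lambda>g\<in>carrier G. d0 G C y g \<otimes>\<^bsub>C\<^esub> c g) ` carrier C"
  by (auto simp: class1_def r_coset_def B1_def Z1_def image_iff)

text \<open>The retraction \<open>r\<close> need not be a homomorphism: it only provides continuity of the
  cochains with values in \<open>A\<close> found by exactness.\<close>

locale topologically_split_sequence =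
  A: topological_gmodule G A + B: topological_gmodule G B + i: group_hom A B i + p: group_hom B C p
  for G :: "('g, 'c) tgroup_scheme" and A :: "('g, 'm1, 'd1) gmod_scheme"
    and B :: "('g, 'm2, 'd2) gmod_scheme" and C :: "('g, 'm3, 'd3) gmod_scheme" and i p +
  fixes r :: "'m2 \<Rightarrow> 'm1"
  assumes i_act: "\<lbrakk>g \<in> carrier G; x \<in> carrier A\<rbrakk> \<Longrightarrow> i (act A g x) = act B g (i x)"
    and p_act: "\<lbrakk>g \<in> carrier G; y \<in> carrier B\<rbrakk> \<Longrightarrow> p (act B g y) = act C g (p y)"
    and retraction: "x \<in> carrier A \<Longrightarrow> r (i x) = x"
    and continuous_retraction: "continuous_map (gtop B) (gtop A) r"
    and surjective: "p ` carrier B = carrier C"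
    and exact: "kernel B C p = i ` carrier A"
begin

lemma i_eqD: "\<lbrakk>i x = i y; x \<in> carrier A; y \<in> carrier A\<rbrakk> \<Longrightarrow> x = y"
  using retraction by metis

lemma mem_imageI: "\<lbrakk>x \<in> carrier B; p x = \<one>\<^bsub>C\<^esub>\<rbrakk> \<Longrightarrow> x \<in> i ` carrier A"
  unfolding exact[symmetric] by (simp add: kernel_def)

lemma act_C_one: "g \<in> carrier G \<Longrightarrow> act C g \<one>\<^bsub>C\<^esub> = \<one>\<^bsub>C\<^esub>"
  using p_act[of g "\<one>\<^bsub>B\<^esub>"] by (simp add: B.act_id)

lemma i_d1:
  assumes "w \<in> carrier G \<rightarrow> carrier A" "q \<in> carrier G \<times> carrier G"
    and "\<And>g. g \<in> carrier G \<Longrightarrow> i (w g) = u g"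
  shows "i (d1 G A w q) = d1 G B u q"
  using assms by (auto simp: A.d1_apply B.d1_apply i_act Pi_iff)

lemma p_d1:
  assumes "b \<in> carrier G \<rightarrow> carrier B" "q \<in> carrier G \<times> carrier G"
    and "\<And>g. g \<in> carrier G \<Longrightarrow> p (b g) = c g"
  shows "p (d1 G B b q) = d1 G C c q"
  using assms by (auto simp: d1_def p_act Pi_iff)

lemma d1_lift_in_image:
  assumes b: "b \<in> carrier G \<rightarrow> carrier B" "\<And>g. g \<in> carrier G \<Longrightarrow> p (b g) = c g"
    and c: "c \<in> carrier (Z1 G C)" and q: "q \<in> carrier G \<times> carrier G"
  shows "d1 G B b q \<in> i ` carrier A"
proof (rule mem_imageI)
  show "d1 G B b q \<in> carrier B"
    using B.d1_closed[OF b(1) q] .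
  show "p (d1 G B b q) = \<one>\<^bsub>C\<^esub>"
    using p_d1[OF b(1) q b(2)] c q by (auto simp: Z1_def)
qed

lemma cochain_in_kernel:
  assumes u: "u \<in> C1 G B" and pu: "\<And>g. g \<in> carrier G \<Longrightarrow> p (u g) = \<one>\<^bsub>C\<^esub>"
  obtains w where "w \<in> C1 G A" "\<forall>g\<in>carrier G. i (w g) = u g"
proof
  show "(\<lambda>g\<in>carrier G. r (u g)) \<in> C1 G A"
    using A.C1_restrictI[OF continuous_map_compose[OF B.C1_continuous[OF u] continuous_retraction]]
    by (simp add: o_def)
  show "\<forall>g\<in>carrier G. i ((\<lambda>g\<in>carrier G. r (u g)) g) = u g"
  proof
    fix g assume g: "g \<in> carrier G"
    show "i ((\<lambda>g\<in>carrier G. r (u g)) g) = u g"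
      using mem_imageI[OF B.C1_closed[OF u g] pu[OF g]] retraction g by auto
  qed
qed

lemma coboundary_of_lift_in_Z2:
  assumes b: "b \<in> C1 G B" and z: "z \<in> carrier G \<times> carrier G \<rightarrow>\<^sub>E carrier A"
    and iz: "\<And>q. q \<in> carrier G \<times> carrier G \<Longrightarrow> i (z q) = d1 G B b q"
  shows "z \<in> carrier (Z2 G A)"
proof -
  have z_closed: "z q \<in> carrier A" if "q \<in> carrier G \<times> carrier G" for q
    using z that by auto
  have "continuous_map (prod_topology (gtop G) (gtop G)) (gtop A) (r \<circ> d1 G B b)"
    using B.d1_C2[OF b] continuous_retraction by (auto simp: C2_def intro: continuous_map_compose)
  then have "continuous_map (prod_topology (gtop G) (gtop G)) (gtop A) z"
    by (rule continuous_map_eq)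
      (use z_closed retraction in \<open>force simp: A.topspace_G simp flip: iz\<close>)
  moreover have "d2 G A z q = \<one>\<^bsub>A\<^esub>" if q: "q \<in> carrier G \<times> carrier G \<times> carrier G" for q
  proof (rule i_eqD)
    have "i (d2 G A z q) = d2 G B (d1 G B b) q"
      using q z_closed by (auto simp: d2_def i_act iz)
    then show "i (d2 G A z q) = i \<one>\<^bsub>A\<^esub>"
      using B.d2_d1[OF B.C1_funcset[OF b] q] by simp
    show "d2 G A z q \<in> carrier A"
      using q z_closed by (auto simp: d2_def)
  qed simp
  ultimately show ?thesis
    using z by (simp add: A.carrier_Z2 C2_def)
qed

lemma class2_unique:
  assumes b: "b \<in> C1 G B" and b': "b' \<in> C1 G B"
    and z: "z \<in> carrier (Z2 G A)" and z': "z' \<in> carrier (Z2 G A)"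
    and same_image: "\<And>g. g \<in> carrier G \<Longrightarrow> p (b' g) = p (b g)"
    and iz: "\<And>q. q \<in> carrier G \<times> carrier G \<Longrightarrow> i (z q) = d1 G B b q"
    and iz': "\<And>q. q \<in> carrier G \<times> carrier G \<Longrightarrow> i (z' q) = d1 G B b' q"
  shows "class2 G A z' = class2 G A z"
proof -
  note b_inv = B.C1_inv[OF b] and closed = B.C1_funcset[OF b] B.C1_funcset[OF b']
  define u where "u = (\<lambda>g\<in>carrier G. b' g \<otimes>\<^bsub>B\<^esub> (\<lambda>g\<in>carrier G. inv\<^bsub>B\<^esub> b g) g)"
  have u: "u \<in> C1 G B"
    unfolding u_def by (rule B.C1_mult[OF b' b_inv])
  have "p (u g) = \<one>\<^bsub>C\<^esub>" if "g \<in> carrier G" for g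
    using that B.C1_closed[OF b that] B.C1_closed[OF b' that] same_image[OF that] by (simp add: u_def)
  from cochain_in_kernel[OF u this]
  obtain w where w: "w \<in> C1 G A" "\<forall>g\<in>carrier G. i (w g) = u g" .
  show ?thesis
  proof (rule A.class2_eqI[OF w(1) z z'])
    fix q assume q: "q \<in> carrier G \<times> carrier G"
    have d1w: "d1 G A w q \<in> carrier A"
      using A.d1_closed[OF A.C1_funcset[OF w(1)] q] .
    have "i (d1 G A w q) = d1 G B u q"
      using w(2) by (intro i_d1[OF A.C1_funcset[OF w(1)] q]) blast
    also have "\<dots> = i (z' q) \<otimes>\<^bsub>B\<^esub> inv\<^bsub>B\<^esub> i (z q)"
      unfolding u_def B.d1_mult[OF closed(2) B.C1_funcset[OF b_inv]] B.d1_inv[OF closed(1)]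
      by (simp add: iz iz' q del: mem_Sigma_iff)
    finally have "i (z' q) = i (d1 G A w q \<otimes>\<^bsub>A\<^esub> z q)"
      using d1w A.Z2_closed[OF z q] A.Z2_closed[OF z' q] by (simp add: B.M.m_assoc)
    then show "z' q = d1 G A w q \<otimes>\<^bsub>A\<^esub> z q"
      using i_eqD d1w A.Z2_closed[OF z q] A.Z2_closed[OF z' q] by blast
  qed
qed

lemma class1_self:
  assumes "c \<in> carrier G \<rightarrow>\<^sub>E carrier C"
  shows "c \<in> class1 G C c"
proof -
  have "c = (\<lambda>g\<in>carrier G. d0 G C \<one>\<^bsub>C\<^esub> g \<otimes>\<^bsub>C\<^esub> c g)"
    using assms by (auto simp: d0_def act_C_one fun_eq_iff PiE_iff extensional_def)
  then show ?thesis
    unfolding class1_eq by blast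
qed

lemma class1_lift:
  assumes b: "b \<in> C1 G B" and pb: "\<And>g. g \<in> carrier G \<Longrightarrow> p (b g) = c g"
    and c': "c' \<in> class1 G C c"
  obtains b' where "b' \<in> C1 G B" "\<forall>g\<in>carrier G. p (b' g) = c' g" "d1 G B b' = d1 G B b"
proof -
  obtain y where y: "y \<in> carrier B" and c'_eq: "c' = (\<lambda>g\<in>carrier G. d0 G C (p y) g \<otimes>\<^bsub>C\<^esub> c g)"
    using c' by (auto simp: class1_eq simp flip: surjective)
  define b' where "b' = (\<lambda>g\<in>carrier G. d0 G B y g \<otimes>\<^bsub>B\<^esub> b g)"
  show thesis
  proof
    show "b' \<in> C1 G B"
      unfolding b'_def by (rule B.C1_mult[OF B.d0_C1[OF y] b])
    show "\<forall>g\<in>carrier G. p (b' g) = c' g"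
      using y B.C1_closed[OF b] pb by (simp add: b'_def c'_eq d0_def p_act)
    show "d1 G B b' = d1 G B b"
    proof (rule extensionalityI[OF B.d1_extensional B.d1_extensional])
      fix q assume q: "q \<in> carrier G \<times> carrier G"
      show "d1 G B b' q = d1 G B b q"
        unfolding b'_def B.d1_mult[OF B.C1_funcset[OF B.d0_C1[OF y]] B.C1_funcset[OF b]]
        using B.d1_closed[OF B.C1_funcset[OF b] q] by (simp add: q B.d1_d0[OF y q] del: mem_Sigma_iff)
    qed
  qed
qed

theorem connecting_class1:
  assumes c: "c \<in> carrier G \<rightarrow>\<^sub>E carrier C"
    and b: "b \<in> C1 G B" and pb: "\<And>g. g \<in> carrier G \<Longrightarrow> p (b g) = c g"
    and z: "z \<in> carrier G \<times> carrier G \<rightarrow>\<^sub>E carrier A"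
    and iz: "\<And>q. q \<in> carrier G \<times> carrier G \<Longrightarrow> i (z q) = d1 G B b q"
  shows "connecting G A B C i p (class1 G C c) = class2 G A z"
  unfolding connecting_def
proof (rule the_equality)
  have zZ2: "z \<in> carrier (Z2 G A)"
    using coboundary_of_lift_in_Z2[OF b z iz] .
  then have "class2 G A z \<in> carrier (H2 G A)"
    by (auto simp: H2_def class2_def carrier_FactGroup)
  then show "class2 G A z \<in> carrier (H2 G A) \<and>
      (\<exists>c\<in>class1 G C c. \<exists>b\<in>C1 G B. \<exists>z'\<in>carrier (Z2 G A).
        (\<forall>g\<in>carrier G. p (b g) = c g) \<and>
        (\<forall>q\<in>carrier G \<times> carrier G. i (z' q) = d1 G B b q) \<and> class2 G A z = class2 G A z')"
    using class1_self[OF c] b pb zZ2 iz by (intro conjI bexI[of _ c] bexI[of _ b] bexI[of _ z]) auto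
  fix y
  assume "y \<in> carrier (H2 G A) \<and>
      (\<exists>c\<in>class1 G C c. \<exists>b\<in>C1 G B. \<exists>z'\<in>carrier (Z2 G A).
        (\<forall>g\<in>carrier G. p (b g) = c g) \<and>
        (\<forall>q\<in>carrier G \<times> carrier G. i (z' q) = d1 G B b q) \<and> y = class2 G A z')"
  then obtain c' b' z' where c': "c' \<in> class1 G C c"
    and b': "b' \<in> C1 G B" "\<forall>g\<in>carrier G. p (b' g) = c' g"
    and z': "z' \<in> carrier (Z2 G A)" "\<forall>q\<in>carrier G \<times> carrier G. i (z' q) = d1 G B b' q"
    and y: "y = class2 G A z'"
    by (elim conjE bexE)
  obtain e where e: "e \<in> C1 G B" "\<forall>g\<in>carrier G. p (e g) = c' g" "d1 G B e = d1 G B b"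
    using class1_lift[OF b pb c'] .
  then show "y = class2 G A z"
    unfolding y by (intro class2_unique[OF e(1) b'(1) zZ2 z'(1)])
      (simp_all add: e b' z' iz del: mem_Sigma_iff)
qed

end

section \<open>Matrices over a module\<close>

text \<open>Keeps the block sizes \<open>a + 1\<close> and \<open>b + 1\<close> in this form under simplification.\<close>

declare One_nat_def [simp del]

lemma (in abelian_monoid) finsum_swap:
  assumes "finite A" "finite B" "\<And>i j. \<lbrakk>i \<in> A; j \<in> B\<rbrakk> \<Longrightarrow> f i j \<in> carrier G"
  shows "(\<Oplus>i\<in>A. \<Oplus>j\<in>B. f i j) = (\<Oplus>j\<in>B. \<Oplus>i\<in>A. f i j)"
  using assms
proof (induction A rule: finite_induct)
  case empty
  then show ?case by (simp add: finsum_zero)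
next
  case (insert x F)
  have "(\<Oplus>i\<in>insert x F. \<Oplus>j\<in>B. f i j) = (\<Oplus>j\<in>B. f x j) \<oplus> (\<Oplus>j\<in>B. \<Oplus>i\<in>F. f i j)"
    using insert by (subst finsum_insert) (auto intro!: finsum_closed)
  also have "\<dots> = (\<Oplus>j\<in>B. f x j \<oplus> (\<Oplus>i\<in>F. f i j))"
    using insert by (subst finsum_addf) (auto intro!: finsum_closed)
  also have "\<dots> = (\<Oplus>j\<in>B. \<Oplus>i\<in>insert x F. f i j)"
    using insert by (intro finsum_cong') (auto intro!: finsum_closed)
  finally show ?case .
qed

lemma (in abelian_monoid) finsum_eq_single:
  assumes "finite A" "k \<in> A" "c k \<in> carrier G" "\<And>i. \<lbrakk>i \<in> A; i \<noteq> k\<rbrakk> \<Longrightarrow> c i = \<zero>"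
  shows "(\<Oplus>i\<in>A. c i) = c k"
proof -
  have "c i \<in> carrier G" if "i \<in> A" for i
    using assms that by (cases "i = k") auto
  then have "(\<Oplus>i\<in>A. c i) = (\<Oplus>i\<in>{k}. c i)"
    using assms by (intro add.finprod_mono_neutral_cong_right) auto
  then show ?thesis
    using assms by simp
qed

lemma (in abelian_group_hom) a_hom_finsum:
  assumes "finite A" "c \<in> A \<rightarrow> carrier G"
  shows "h (\<Oplus>\<^bsub>G\<^esub>i\<in>A. c i) = (\<Oplus>\<^bsub>H\<^esub>i\<in>A. h (c i))"
  using assms
proof (induction A rule: finite_induct)
  case (insert i A)
  then show ?case
    by (simp add: Pi_iff G.finsum_insert H.finsum_insert G.finsum_closed)
qed simp

abbreviation matrices :: "('s, 'e) partial_object_scheme \<Rightarrow> nat \<Rightarrow> nat \<Rightarrow> (nat \<times> nat \<Rightarrow> 's) set" where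
  "matrices S m n \<equiv> mat_idx m n \<rightarrow>\<^sub>E carrier S"

definition mat_transpose :: "nat \<Rightarrow> nat \<Rightarrow> (nat \<times> nat \<Rightarrow> 's) \<Rightarrow> nat \<times> nat \<Rightarrow> 's" where
  "mat_transpose m n X = (\<lambda>(i, j)\<in>mat_idx n m. X (j, i))"

lemma matrix_entry: "\<lbrakk>X \<in> matrices S m n; i \<in> {1..m}; j \<in> {1..n}\<rbrakk> \<Longrightarrow> X (i, j) \<in> carrier S"
  by (auto simp: mat_idx_def PiE_iff)

lemma matrix_extensional: "X \<in> matrices S m n \<Longrightarrow> X \<in> extensional (mat_idx m n)"
  by (simp add: PiE_def)

lemma matrixI:
  assumes "X \<in> extensional (mat_idx m n)" "\<And>i j. \<lbrakk>i \<in> {1..m}; j \<in> {1..n}\<rbrakk> \<Longrightarrow> X (i, j) \<in> carrier S"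
  shows "X \<in> matrices S m n"
  using assms by (auto simp: PiE_iff mat_idx_def)

lemma matrix_eqI:
  assumes "X \<in> extensional (mat_idx m n)" "Y \<in> extensional (mat_idx m n)"
    and "\<And>i j. \<lbrakk>i \<in> {1..m}; j \<in> {1..n}\<rbrakk> \<Longrightarrow> X (i, j) = Y (i, j)"
  shows "X = Y"
  using assms by (intro extensionalityI[of X "mat_idx m n"]) (auto simp: mat_idx_def)

lemmas mat_defs = rmat_mult_def rmat_one_def mat_lmult_def mat_rmult_def mat_add_def mat_zero_def
  mat_act_def mat_corner_def mat_transpose_def

lemma mat_extensional [simp]:
  "rmat_mult R k A B \<in> extensional (mat_idx k k)"
  "rmat_one R k \<in> extensional (mat_idx k k)"
  "mat_lmult T m n P X \<in> extensional (mat_idx m n)"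
  "mat_rmult T m n X Q \<in> extensional (mat_idx m n)"
  "mat_add T' m n X Y \<in> extensional (mat_idx m n)"
  "mat_zero T' m n \<in> extensional (mat_idx m n)"
  "mat_act T'' m n g X \<in> extensional (mat_idx m n)"
  "mat_corner T' m n t \<in> extensional (mat_idx m n)"
  "mat_transpose m n X \<in> extensional (mat_idx n m)"
  by (auto simp: mat_defs)

lemma mat_lmult_entry: "\<lbrakk>i \<in> {1..m}; j \<in> {1..n}\<rbrakk> \<Longrightarrow>
    mat_lmult T m n P X (i, j) = (\<Oplus>\<^bsub>T\<^esub>l\<in>{1..m}. P (i, l) \<odot>\<^bsub>T\<^esub> X (l, j))"
  and mat_rmult_entry: "\<lbrakk>i \<in> {1..m}; j \<in> {1..n}\<rbrakk> \<Longrightarrow>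
    mat_rmult T m n X Q (i, j) = (\<Oplus>\<^bsub>T\<^esub>l\<in>{1..n}. Q (l, j) \<odot>\<^bsub>T\<^esub> X (i, l))"
  and rmat_mult_entry: "\<lbrakk>i \<in> {1..k}; j \<in> {1..k}\<rbrakk> \<Longrightarrow>
    rmat_mult R k A B (i, j) = (\<Oplus>\<^bsub>R\<^esub>l\<in>{1..k}. A (i, l) \<otimes>\<^bsub>R\<^esub> B (l, j))"
  and rmat_one_entry: "\<lbrakk>i \<in> {1..k}; j \<in> {1..k}\<rbrakk> \<Longrightarrow>
    rmat_one R k (i, j) = (if i = j then \<one>\<^bsub>R\<^esub> else \<zero>\<^bsub>R\<^esub>)"
  and mat_add_entry: "\<lbrakk>i \<in> {1..m}; j \<in> {1..n}\<rbrakk> \<Longrightarrow> mat_add T' m n X Y (i, j) = X (i, j) \<oplus>\<^bsub>T'\<^esub> Y (i, j)"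
  and mat_act_entry: "\<lbrakk>i \<in> {1..m}; j \<in> {1..n}\<rbrakk> \<Longrightarrow> mat_act T'' m n g X (i, j) = mact T'' g (X (i, j))"
  and mat_corner_entry: "\<lbrakk>i \<in> {1..m}; j \<in> {1..n}\<rbrakk> \<Longrightarrow>
    mat_corner T' m n t (i, j) = (if (i, j) = (1, n) then t else \<zero>\<^bsub>T'\<^esub>)"
  and mat_transpose_entry: "\<lbrakk>i \<in> {1..n}; j \<in> {1..m}\<rbrakk> \<Longrightarrow> mat_transpose m n X (i, j) = X (j, i)"
  by (simp_all add: mat_defs mat_idx_def)

lemmas mat_entry = mat_lmult_entry mat_rmult_entry rmat_mult_entry rmat_one_entry mat_add_entry
  mat_act_entry mat_corner_entry mat_transpose_entry

lemma mat_transpose_closed [simp]: "X \<in> matrices S m n \<Longrightarrow> mat_transpose m n X \<in> matrices S n m"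
  by (rule matrixI) (auto simp: mat_entry matrix_entry)

lemma mat_transpose_transpose:
  "X \<in> extensional (mat_idx m n) \<Longrightarrow> mat_transpose n m (mat_transpose m n X) = X"
  by (rule matrix_eqI[of _ m n]) (auto simp: mat_entry)

lemma mat_transpose_one: "mat_transpose k k (rmat_one R k) = rmat_one R k"
  by (rule matrix_eqI[of _ k k]) (auto simp: mat_entry)

lemma mat_transpose_add:
  "mat_transpose m n (mat_add T m n X Y) = mat_add T n m (mat_transpose m n X) (mat_transpose m n Y)"
  by (rule matrix_eqI[of _ n m]) (auto simp: mat_entry)

lemma mat_transpose_act:
  "mat_transpose m n (mat_act T m n g X) = mat_act T n m g (mat_transpose m n X)"
  by (rule matrix_eqI[of _ n m]) (auto simp: mat_entry)

lemma (in cring) mat_transpose_rmat_mult: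
  assumes "A \<in> matrices R k k" "B \<in> matrices R k k"
  shows "mat_transpose k k (rmat_mult R k A B) =
    rmat_mult R k (mat_transpose k k B) (mat_transpose k k A)"
proof (rule matrix_eqI)
  fix i j assume ij: "i \<in> {1..k}" "j \<in> {1..k}"
  have "(\<Oplus>l\<in>{1..k}. A (j, l) \<otimes> B (l, i)) =
      (\<Oplus>l\<in>{1..k}. mat_transpose k k B (i, l) \<otimes> mat_transpose k k A (l, j))"
    using assms ij by (intro finsum_cong') (auto simp: mat_entry matrix_entry m_comm)
  then show "mat_transpose k k (rmat_mult R k A B) (i, j) =
      rmat_mult R k (mat_transpose k k B) (mat_transpose k k A) (i, j)"
    using ij by (simp add: mat_transpose_entry rmat_mult_entry)
qed auto

subsection \<open>The additive group of matrices\<close>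

definition mat_group :: "('t, 'e) ring_scheme \<Rightarrow> nat \<Rightarrow> nat \<Rightarrow> (nat \<times> nat \<Rightarrow> 't) monoid" where
  "mat_group T m n = product_group (mat_idx m n) (\<lambda>_. add_monoid T)"

lemma mat_group_simps:
  "carrier (mat_group T m n) = matrices T m n" "mult (mat_group T m n) = mat_add T m n"
  "one (mat_group T m n) = mat_zero T m n"
  by (simp_all add: mat_group_def mat_add_def[abs_def] mat_zero_def)

context abelian_group begin

lemma comm_group_mat_group: "comm_group (mat_group G m n)"
  unfolding mat_group_def by (intro comm_group_product_group a_comm_group)

sublocale mat: comm_group "mat_group G m n"
  rewrites "carrier (mat_group G m n) = matrices G m n" and "mult (mat_group G m n) = mat_add G m n"
    and "one (mat_group G m n) = mat_zero G m n" for m n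
  by (rule comm_group_mat_group) (rule mat_group_simps)+

lemma inv_mat_group: "X \<in> matrices G m n \<Longrightarrow> inv\<^bsub>mat_group G m n\<^esub> X = (\<lambda>q\<in>mat_idx m n. \<ominus> X q)"
  unfolding mat_group_def a_inv_def by (subst inv_product_group) (auto simp: PiE_iff)

lemma mat_corner_closed [simp]: "t \<in> carrier G \<Longrightarrow> mat_corner G m n t \<in> matrices G m n"
  by (rule matrixI) (auto simp: mat_entry)

lemma mat_corner_zero: "mat_corner G m n \<zero> = mat_zero G m n"
  by (simp add: mat_corner_def mat_zero_def restrict_def fun_eq_iff)

lemma mat_corner_add:
  assumes "s \<in> carrier G" "t \<in> carrier G"
  shows "mat_add G m n (mat_corner G m n s) (mat_corner G m n t) = mat_corner G m n (s \<oplus> t)"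
  by (rule matrix_eqI[of _ m n]) (use assms in \<open>auto simp: mat_entry\<close>)

end

subsection \<open>Multiplication from the left and from the right\<close>

context module begin

lemma finsum_smult_rdistr:
  assumes "finite A" "c \<in> A \<rightarrow> carrier R" "x \<in> carrier M"
  shows "(\<Oplus>\<^bsub>R\<^esub>i\<in>A. c i) \<odot>\<^bsub>M\<^esub> x = (\<Oplus>\<^bsub>M\<^esub>i\<in>A. c i \<odot>\<^bsub>M\<^esub> x)"
proof -
  have "abelian_group_hom R M (\<lambda>r. r \<odot>\<^bsub>M\<^esub> x)"
  proof (rule abelian_group_homI)
    show "group_hom (add_monoid R) (add_monoid M) (\<lambda>r. r \<odot>\<^bsub>M\<^esub> x)"
      using assms by unfold_locales (auto simp: hom_def smult_l_distr)
  qed unfold_locales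
  then show ?thesis
    using abelian_group_hom.a_hom_finsum assms(1,2) by blast
qed

lemma mat_lmult_closed [simp]:
  "\<lbrakk>P \<in> matrices R m m; X \<in> matrices M m n\<rbrakk> \<Longrightarrow> mat_lmult M m n P X \<in> matrices M m n"
  by (rule matrixI) (auto simp: mat_entry matrix_entry intro!: M.finsum_closed)

lemma mat_lmult_lmult:
  assumes P: "P \<in> matrices R m m" and P': "P' \<in> matrices R m m" and X: "X \<in> matrices M m n"
  shows "mat_lmult M m n P (mat_lmult M m n P' X) = mat_lmult M m n (rmat_mult R m P P') X"
proof (rule matrix_eqI)
  fix i j assume ij: "i \<in> {1..m}" "j \<in> {1..n}"
  note closed = matrix_entry[OF P] matrix_entry[OF P'] matrix_entry[OF X]
  have "mat_lmult M m n P (mat_lmult M m n P' X) (i, j) =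
      (\<Oplus>\<^bsub>M\<^esub>l\<in>{1..m}. \<Oplus>\<^bsub>M\<^esub>k\<in>{1..m}. (P (i, l) \<otimes>\<^bsub>R\<^esub> P' (l, k)) \<odot>\<^bsub>M\<^esub> X (k, j))"
    using closed ij
    by (auto simp: mat_entry finsum_smult_ldistr smult_assoc1 intro!: M.finsum_cong' M.finsum_closed)
  also have "\<dots> = (\<Oplus>\<^bsub>M\<^esub>k\<in>{1..m}. \<Oplus>\<^bsub>M\<^esub>l\<in>{1..m}. (P (i, l) \<otimes>\<^bsub>R\<^esub> P' (l, k)) \<odot>\<^bsub>M\<^esub> X (k, j))"
    using closed ij by (intro M.finsum_swap) auto
  also have "\<dots> = mat_lmult M m n (rmat_mult R m P P') X (i, j)"
    using closed ij
    by (auto simp: mat_entry finsum_smult_rdistr intro!: M.finsum_cong' R.finsum_closed)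
  finally show "mat_lmult M m n P (mat_lmult M m n P' X) (i, j) =
      mat_lmult M m n (rmat_mult R m P P') X (i, j)" .
qed auto

lemma mat_lmult_add:
  assumes "P \<in> matrices R m m" "X \<in> matrices M m n" "Y \<in> matrices M m n"
  shows "mat_lmult M m n P (mat_add M m n X Y) =
    mat_add M m n (mat_lmult M m n P X) (mat_lmult M m n P Y)"
proof (rule matrix_eqI)
  fix i j assume ij: "i \<in> {1..m}" "j \<in> {1..n}"
  have "mat_lmult M m n P (mat_add M m n X Y) (i, j) =
      (\<Oplus>\<^bsub>M\<^esub>l\<in>{1..m}. P (i, l) \<odot>\<^bsub>M\<^esub> X (l, j) \<oplus>\<^bsub>M\<^esub> P (i, l) \<odot>\<^bsub>M\<^esub> Y (l, j))"
    unfolding mat_lmult_entry[OF ij] using assms ij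
    by (intro M.finsum_cong') (auto simp: mat_entry matrix_entry smult_r_distr)
  also have "\<dots> = mat_add M m n (mat_lmult M m n P X) (mat_lmult M m n P Y) (i, j)"
    using assms ij by (simp add: mat_entry matrix_entry M.finsum_addf)
  finally show "mat_lmult M m n P (mat_add M m n X Y) (i, j) =
      mat_add M m n (mat_lmult M m n P X) (mat_lmult M m n P Y) (i, j)" .
qed auto

lemma mat_lmult_one:
  assumes X: "X \<in> matrices M m n"
  shows "mat_lmult M m n (rmat_one R m) X = X"
proof (rule matrix_eqI)
  fix i j assume ij: "i \<in> {1..m}" "j \<in> {1..n}"
  have "mat_lmult M m n (rmat_one R m) X (i, j) = rmat_one R m (i, i) \<odot>\<^bsub>M\<^esub> X (i, j)"
    unfolding mat_lmult_entry[OF ij]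
    by (rule M.finsum_eq_single) (use X ij in \<open>auto simp: mat_entry matrix_entry\<close>)
  then show "mat_lmult M m n (rmat_one R m) X (i, j) = X (i, j)"
    using X ij by (simp add: mat_entry matrix_entry)
qed (use X matrix_extensional in auto)

lemma mat_lmult_eq_self:
  assumes P: "P \<in> matrices R m m" and X: "X \<in> matrices M m n" and p: "p \<in> {1..m}"
    and column: "\<And>i. i \<in> {1..m} \<Longrightarrow> P (i, p) = rmat_one R m (i, p)"
    and rows: "\<And>i j. \<lbrakk>i \<in> {1..m}; j \<in> {1..n}; i \<noteq> p\<rbrakk> \<Longrightarrow> X (i, j) = \<zero>\<^bsub>M\<^esub>"
  shows "mat_lmult M m n P X = X"
proof (rule matrix_eqI)
  fix i j assume ij: "i \<in> {1..m}" "j \<in> {1..n}"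
  have "mat_lmult M m n P X (i, j) = P (i, p) \<odot>\<^bsub>M\<^esub> X (p, j)"
    unfolding mat_lmult_entry[OF ij]
    by (rule M.finsum_eq_single) (use ij p rows matrix_entry[OF P] matrix_entry[OF X] in auto)
  then show "mat_lmult M m n P X (i, j) = X (i, j)"
    using ij p rows[OF ij] matrix_entry[OF X p ij(2)] by (simp add: column rmat_one_entry)
qed (use X matrix_extensional in auto)

lemma mat_rmult_eq_transpose:
  assumes X: "X \<in> matrices M m n" and Q: "Q \<in> matrices R n n"
  shows "mat_rmult M m n X Q =
    mat_transpose n m (mat_lmult M n m (mat_transpose n n Q) (mat_transpose m n X))"
proof (rule matrix_eqI)
  fix i j assume ij: "i \<in> {1..m}" "j \<in> {1..n}"
  have "(\<Oplus>\<^bsub>M\<^esub>l\<in>{1..n}. Q (l, j) \<odot>\<^bsub>M\<^esub> X (i, l)) =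
      (\<Oplus>\<^bsub>M\<^esub>l\<in>{1..n}. mat_transpose n n Q (j, l) \<odot>\<^bsub>M\<^esub> mat_transpose m n X (l, i))"
    using ij
    by (intro M.finsum_cong') (auto simp: mat_transpose_entry matrix_entry[OF X] matrix_entry[OF Q])
  then show "mat_rmult M m n X Q (i, j) =
      mat_transpose n m (mat_lmult M n m (mat_transpose n n Q) (mat_transpose m n X)) (i, j)"
    using ij by (simp add: mat_rmult_entry mat_lmult_entry mat_transpose_entry)
qed auto

lemma mat_rmult_closed [simp]:
  "\<lbrakk>X \<in> matrices M m n; Q \<in> matrices R n n\<rbrakk> \<Longrightarrow> mat_rmult M m n X Q \<in> matrices M m n"
  by (simp add: mat_rmult_eq_transpose)

lemma mat_rmult_rmult:
  assumes "X \<in> matrices M m n" "Q \<in> matrices R n n" "Q' \<in> matrices R n n"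
  shows "mat_rmult M m n (mat_rmult M m n X Q) Q' = mat_rmult M m n X (rmat_mult R n Q Q')"
proof -
  have "rmat_mult R n Q Q' \<in> matrices R n n"
    using assms by (intro matrixI) (auto simp: mat_entry matrix_entry intro!: R.finsum_closed)
  then show ?thesis
    using assms by (simp add: mat_rmult_eq_transpose mat_transpose_transpose mat_lmult_lmult
        mat_transpose_rmat_mult)
qed

lemma mat_rmult_add:
  assumes "Q \<in> matrices R n n" "X \<in> matrices M m n" "Y \<in> matrices M m n"
  shows "mat_rmult M m n (mat_add M m n X Y) Q =
    mat_add M m n (mat_rmult M m n X Q) (mat_rmult M m n Y Q)"
  using assms M.mat.m_closed[OF assms(2,3)]
  by (simp add: mat_rmult_eq_transpose mat_transpose_add mat_lmult_add)

lemma mat_rmult_one: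
  assumes "X \<in> matrices M m n"
  shows "mat_rmult M m n X (rmat_one R n) = X"
proof -
  have "rmat_one R n \<in> matrices R n n"
    by (rule matrixI) (auto simp: mat_entry)
  then show ?thesis
    using assms matrix_extensional[OF assms]
    by (simp add: mat_rmult_eq_transpose mat_transpose_one mat_lmult_one mat_transpose_transpose)
qed

lemma mat_rmult_eq_self:
  assumes Q: "Q \<in> matrices R n n" and X: "X \<in> matrices M m n" and p: "p \<in> {1..n}"
    and "\<And>j. j \<in> {1..n} \<Longrightarrow> Q (p, j) = rmat_one R n (p, j)"
    and "\<And>i j. \<lbrakk>i \<in> {1..m}; j \<in> {1..n}; j \<noteq> p\<rbrakk> \<Longrightarrow> X (i, j) = \<zero>\<^bsub>M\<^esub>"
  shows "mat_rmult M m n X Q = X"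
proof -
  have "mat_lmult M n m (mat_transpose n n Q) (mat_transpose m n X) = mat_transpose m n X"
    by (rule mat_lmult_eq_self[where p = p])
      (use assms in \<open>auto simp: mat_transpose_entry rmat_one_entry\<close>)
  then show ?thesis
    using Q X matrix_extensional[OF X] by (simp add: mat_rmult_eq_transpose mat_transpose_transpose)
qed

lemma mat_lmult_rmult:
  assumes P: "P \<in> matrices R m m" and X: "X \<in> matrices M m n" and Q: "Q \<in> matrices R n n"
  shows "mat_lmult M m n P (mat_rmult M m n X Q) = mat_rmult M m n (mat_lmult M m n P X) Q"
proof (rule matrix_eqI)
  fix i j assume ij: "i \<in> {1..m}" "j \<in> {1..n}"
  note closed = matrix_entry[OF P] matrix_entry[OF X] matrix_entry[OF Q]
  have "mat_lmult M m n P (mat_rmult M m n X Q) (i, j) =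
      (\<Oplus>\<^bsub>M\<^esub>l\<in>{1..m}. \<Oplus>\<^bsub>M\<^esub>k\<in>{1..n}. P (i, l) \<odot>\<^bsub>M\<^esub> (Q (k, j) \<odot>\<^bsub>M\<^esub> X (l, k)))"
    using closed ij
    by (auto simp: mat_entry finsum_smult_ldistr intro!: M.finsum_cong' M.finsum_closed)
  also have "\<dots> = (\<Oplus>\<^bsub>M\<^esub>k\<in>{1..n}. \<Oplus>\<^bsub>M\<^esub>l\<in>{1..m}. P (i, l) \<odot>\<^bsub>M\<^esub> (Q (k, j) \<odot>\<^bsub>M\<^esub> X (l, k)))"
    using closed ij by (intro M.finsum_swap) auto
  also have "\<dots> = (\<Oplus>\<^bsub>M\<^esub>k\<in>{1..n}. \<Oplus>\<^bsub>M\<^esub>l\<in>{1..m}. Q (k, j) \<odot>\<^bsub>M\<^esub> (P (i, l) \<odot>\<^bsub>M\<^esub> X (l, k)))"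
    using closed ij
    by (intro M.finsum_cong')
      (auto simp: R.m_comm simp flip: smult_assoc1 intro!: M.finsum_closed)
  also have "\<dots> = mat_rmult M m n (mat_lmult M m n P X) Q (i, j)"
    using closed ij
    by (auto simp: mat_entry finsum_smult_ldistr intro!: M.finsum_cong' M.finsum_closed)
  finally show "mat_lmult M m n P (mat_rmult M m n X Q) (i, j) =
      mat_rmult M m n (mat_lmult M m n P X) Q (i, j)" .
qed auto

end

subsection \<open>Unitriangular matrices\<close>

definition regular_module :: "('r, 'd) ring_scheme \<Rightarrow> ('r, 'r) module" where
  "regular_module R = \<lparr>carrier = carrier R, monoid.mult = (\<otimes>\<^bsub>R\<^esub>), one = \<one>\<^bsub>R\<^esub>,
    zero = \<zero>\<^bsub>R\<^esub>, add = (\<oplus>\<^bsub>R\<^esub>), smult = (\<otimes>\<^bsub>R\<^esub>)\<rparr>"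

lemma rmat_mult_eq_lmult: "rmat_mult R k A B = mat_lmult (regular_module R) k k A B"
  by (simp add: rmat_mult_def mat_lmult_def finsum_def finprod_def regular_module_def)

definition unitriangular :: "('r, 'd) ring_scheme \<Rightarrow> nat \<Rightarrow> (nat \<times> nat \<Rightarrow> 'r) set" where
  "unitriangular R k = {A \<in> matrices R k k.
    (\<forall>i\<in>{1..k}. A (i, i) = \<one>\<^bsub>R\<^esub>) \<and> (\<forall>i\<in>{1..k}. \<forall>j\<in>{1..k}. j < i \<longrightarrow> A (i, j) = \<zero>\<^bsub>R\<^esub>)}"

lemma unitriangular_matrix: "A \<in> unitriangular R k \<Longrightarrow> A \<in> matrices R k k"
  by (simp add: unitriangular_def)

lemma unitriangular_diag: "\<lbrakk>A \<in> unitriangular R k; i \<in> {1..k}\<rbrakk> \<Longrightarrow> A (i, i) = \<one>\<^bsub>R\<^esub>"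
  by (simp add: unitriangular_def)

lemma unitriangular_lower: "\<lbrakk>A \<in> unitriangular R k; i \<in> {1..k}; j \<in> {1..k}; j < i\<rbrakk> \<Longrightarrow> A (i, j) = \<zero>\<^bsub>R\<^esub>"
  by (simp add: unitriangular_def)

lemma unitriangular_entry: "\<lbrakk>A \<in> unitriangular R k; i \<in> {1..k}; j \<in> {1..k}\<rbrakk> \<Longrightarrow> A (i, j) \<in> carrier R"
  using unitriangular_matrix matrix_entry by metis

lemma unitri_simps [simp]:
  "carrier (unitri R k) = unitriangular R k" "mult (unitri R k) = rmat_mult R k"
  "one (unitri R k) = rmat_one R k"
  by (simp_all add: unitri_def unitriangular_def Let_def)

context cring begin

lemma module_regular: "module R (regular_module R)"
proof (rule moduleI)
  show "abelian_group (regular_module R)"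
    by (rule abelian_groupI) (auto simp: regular_module_def a_ac intro: add.l_inv_ex)
qed (auto simp: regular_module_def is_cring l_distr r_distr m_assoc)

lemma rmat_mult_closed:
  "\<lbrakk>A \<in> matrices R k k; B \<in> matrices R k k\<rbrakk> \<Longrightarrow> rmat_mult R k A B \<in> matrices R k k"
  using module.mat_lmult_closed[OF module_regular, of A k B k]
  by (simp add: rmat_mult_eq_lmult regular_module_def)

lemma rmat_mult_assoc:
  assumes "A \<in> matrices R k k" "B \<in> matrices R k k" "C \<in> matrices R k k"
  shows "rmat_mult R k (rmat_mult R k A B) C = rmat_mult R k A (rmat_mult R k B C)"
  using module.mat_lmult_lmult[OF module_regular, of A k B C k] assms
  by (simp add: rmat_mult_eq_lmult regular_module_def)

lemma rmat_mult_one_left: "A \<in> matrices R k k \<Longrightarrow> rmat_mult R k (rmat_one R k) A = A"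
  using module.mat_lmult_one[OF module_regular, of A k k]
  by (simp add: rmat_mult_eq_lmult regular_module_def)

lemma rmat_mult_one_right:
  assumes A: "A \<in> matrices R k k"
  shows "rmat_mult R k A (rmat_one R k) = A"
proof -
  have "rmat_one R k \<in> matrices R k k"
    by (rule matrixI) (auto simp: mat_entry)
  then have "mat_transpose k k (rmat_mult R k A (rmat_one R k)) = mat_transpose k k A"
    using A by (simp add: mat_transpose_rmat_mult mat_transpose_one rmat_mult_one_left)
  then have "mat_transpose k k (mat_transpose k k (rmat_mult R k A (rmat_one R k))) =
      mat_transpose k k (mat_transpose k k A)"
    by (rule arg_cong)
  then show ?thesis
    by (simp add: mat_transpose_transpose matrix_extensional[OF A])
qed

lemma rmat_one_unitriangular: "rmat_one R k \<in> unitriangular R k"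
  by (auto simp: unitriangular_def mat_entry intro!: matrixI)

lemma unitriangular_mult_entry:
  assumes A: "A \<in> unitriangular R k" and B: "B \<in> unitriangular R k"
    and i: "i \<in> {1..k}" and j: "j \<in> {1..k}"
  shows "rmat_mult R k A B (i, j) = (\<Oplus>l\<in>{i..j}. A (i, l) \<otimes> B (l, j))"
  unfolding rmat_mult_entry[OF i j]
proof (rule add.finprod_mono_neutral_cong_right)
  fix l assume l: "l \<in> {1..k} - {i..j}"
  then have "l < i \<or> j < l"
    by auto
  then show "A (i, l) \<otimes> B (l, j) = \<zero>"
    using l j unitriangular_lower[OF A i, of l] unitriangular_lower[OF B _ j, of l]
      unitriangular_entry[OF A i, of l] unitriangular_entry[OF B _ j, of l] by auto
qed (use i j in \<open>auto simp: unitriangular_entry[OF A] unitriangular_entry[OF B]\<close>)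

lemma unitriangular_mult:
  assumes A: "A \<in> unitriangular R k" and B: "B \<in> unitriangular R k"
  shows "rmat_mult R k A B \<in> unitriangular R k"
  using rmat_mult_closed[OF unitriangular_matrix[OF A] unitriangular_matrix[OF B]]
  by (auto simp: unitriangular_def unitriangular_mult_entry[OF A B] unitriangular_diag[OF A]
      unitriangular_diag[OF B])

lemma unitriangular_eq_one:
  assumes A: "A \<in> unitriangular R k"
    and upper: "\<And>i j. \<lbrakk>i \<in> {1..k}; j \<in> {1..k}; i < j\<rbrakk> \<Longrightarrow> A (i, j) = \<zero>"
  shows "A = rmat_one R k"
proof (rule matrix_eqI)
  fix i j assume ij: "i \<in> {1..k}" "j \<in> {1..k}"
  consider "i = j" | "i < j" | "j < i" by linarith
  then show "A (i, j) = rmat_one R k (i, j)"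
    using unitriangular_diag[OF A ij(1)] unitriangular_lower[OF A ij] upper[OF ij] ij
    by cases (auto simp: rmat_one_entry)
qed (use unitriangular_matrix[OF A] matrix_extensional in auto)

text \<open>If \<open>A - 1\<close> vanishes on the first \<open>d - 1\<close> superdiagonals, then \<open>(2 - A) A = 1 - (A - 1)\<^sup>2\<close>
  differs from \<open>1\<close> only beyond the \<open>d\<close>-th one.\<close>

lemma unitriangular_clear_superdiagonal:
  assumes A: "A \<in> unitriangular R k"
    and band: "\<And>i j. \<lbrakk>i \<in> {1..k}; j \<in> {1..k}; i < j; j < i + d\<rbrakk> \<Longrightarrow> A (i, j) = \<zero>"
  obtains C where "C \<in> unitriangular R k"
    "\<forall>i\<in>{1..k}. \<forall>j\<in>{1..k}. i < j \<and> j < i + Suc d \<longrightarrow> rmat_mult R k C A (i, j) = \<zero>"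
proof
  define C where "C = (\<lambda>(i, j)\<in>mat_idx k k. if i = j then \<one> else \<ominus> A (i, j))"
  have C_entry: "C (i, j) = (if i = j then \<one> else \<ominus> A (i, j))" if "i \<in> {1..k}" "j \<in> {1..k}" for i j
    using that by (simp add: C_def mat_idx_def)
  show C: "C \<in> unitriangular R k"
    unfolding unitriangular_def
    by (auto simp: C_entry unitriangular_entry[OF A] unitriangular_lower[OF A] intro!: matrixI)
      (simp add: C_def)
  have "rmat_mult R k C A (i, j) = \<zero>"
    if i: "i \<in> {1..k}" and j: "j \<in> {1..k}" and ij: "i < j" "j < i + Suc d" for i j
  proof -
    have "rmat_mult R k C A (i, j) = (\<Oplus>l\<in>{i, j}. C (i, l) \<otimes> A (l, j))"
      unfolding unitriangular_mult_entry[OF C A i j]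
      by (rule add.finprod_mono_neutral_cong_right)
        (use i j ij band in \<open>auto simp: C_entry unitriangular_entry[OF A]\<close>)
    also have "\<dots> = C (i, i) \<otimes> A (i, j) \<oplus> C (i, j) \<otimes> A (j, j)"
      using i j ij
      by (subst finsum_insert) (auto simp: unitriangular_entry[OF A] unitriangular_entry[OF C])
    finally show ?thesis
      using i j ij unitriangular_entry[OF A i j] unitriangular_diag[OF A j]
      by (simp add: C_entry r_neg)
  qed
  then show "\<forall>i\<in>{1..k}. \<forall>j\<in>{1..k}. i < j \<and> j < i + Suc d \<longrightarrow> rmat_mult R k C A (i, j) = \<zero>"
    by blast
qed

lemma unitriangular_left_inverse:
  assumes "A \<in> unitriangular R k"
    and "\<And>i j. \<lbrakk>i \<in> {1..k}; j \<in> {1..k}; i < j; j < i + d\<rbrakk> \<Longrightarrow> A (i, j) = \<zero>"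
  shows "\<exists>B\<in>unitriangular R k. rmat_mult R k B A = rmat_one R k"
  using assms
proof (induction "k - d" arbitrary: A d rule: less_induct)
  case less
  note A = less.prems(1)
  show ?case
  proof (cases "d < k")
    case False
    then have "A = rmat_one R k"
      by (intro unitriangular_eq_one[OF A] less.prems(2)) auto
    then show ?thesis
      using A rmat_mult_one_left[OF unitriangular_matrix[OF A]] by auto
  next
    case True
    obtain C where C: "C \<in> unitriangular R k"
      "\<forall>i\<in>{1..k}. \<forall>j\<in>{1..k}. i < j \<and> j < i + Suc d \<longrightarrow> rmat_mult R k C A (i, j) = \<zero>"
      using unitriangular_clear_superdiagonal[OF less.prems] .
    moreover have "k - Suc d < k - d"
      using True by linarith
    ultimately obtain B where B: "B \<in> unitriangular R k"
      "rmat_mult R k B (rmat_mult R k C A) = rmat_one R k"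
      using less.hyps[OF _ unitriangular_mult[OF C(1) A], of "Suc d"] by auto
    then have "rmat_mult R k (rmat_mult R k B C) A = rmat_one R k"
      using rmat_mult_assoc A C(1) by (simp add: unitriangular_matrix)
    then show ?thesis
      using unitriangular_mult[OF B(1) C(1)] by blast
  qed
qed

lemma group_unitri:
  fixes S :: "('r, 'e) tring_scheme"
  assumes "cring S"
  shows "group (unitri S k)"
proof -
  interpret S: cring S by fact
  show ?thesis
  proof (rule groupI)
    show "\<exists>B\<in>carrier (unitri S k). B \<otimes>\<^bsub>unitri S k\<^esub> A = \<one>\<^bsub>unitri S k\<^esub>" if "A \<in> carrier (unitri S k)" for A
      using S.unitriangular_left_inverse[of A k 1] that by simp
  qed (auto simp: S.unitriangular_mult S.rmat_one_unitriangular S.rmat_mult_assoc S.rmat_mult_one_left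
      unitriangular_matrix)
qed

end

context module begin

lemma mat_lmult_corner:
  assumes P: "P \<in> unitriangular R m" and t: "t \<in> carrier M" and "1 \<le> m"
  shows "mat_lmult M m n P (mat_corner M m n t) = mat_corner M m n t"
proof (rule mat_lmult_eq_self[where p = 1])
  show "P (i, 1) = rmat_one R m (i, 1)" if "i \<in> {1..m}" for i
    using that unitriangular_diag[OF P that] unitriangular_lower[OF P that, of 1]
    by (auto simp: rmat_one_entry)
qed (use assms in \<open>auto simp: mat_corner_entry unitriangular_matrix\<close>)

lemma mat_rmult_corner:
  assumes Q: "Q \<in> unitriangular R n" and t: "t \<in> carrier M" and "1 \<le> n"
  shows "mat_rmult M m n (mat_corner M m n t) Q = mat_corner M m n t"
proof (rule mat_rmult_eq_self[where p = n])
  show "Q (n, j) = rmat_one R n (n, j)" if "j \<in> {1..n}" for j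
    using that unitriangular_diag[OF Q that] unitriangular_lower[OF Q _ that, of n]
    by (auto simp: rmat_one_entry)
qed (use assms in \<open>auto simp: mat_corner_entry unitriangular_matrix\<close>)

lemma mat_rmult_first_column:
  assumes Q: "Q \<in> unitriangular R n" and X: "X \<in> matrices M m n" and i: "i \<in> {1..m}" and n: "1 \<le> n"
  shows "mat_rmult M m n X Q (i, 1) = X (i, 1)"
proof -
  have one: "1 \<in> {1..n}"
    using n by simp
  have "mat_rmult M m n X Q (i, 1) = Q (1, 1) \<odot>\<^bsub>M\<^esub> X (i, 1)"
    unfolding mat_rmult_entry[OF i one]
    by (rule M.finsum_eq_single)
      (use i one unitriangular_lower[OF Q] unitriangular_entry[OF Q] matrix_entry[OF X] in auto)
  then show ?thesis
    using unitriangular_diag[OF Q one] matrix_entry[OF X i one] by simp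
qed

end

section \<open>Quotients by normal subgroups\<close>

lemma group_cong:
  assumes "group H" and "carrier K = carrier H" "mult K = mult H" "one K = one H"
  shows "group K"
proof -
  interpret group H by fact
  show ?thesis
    by (rule groupI) (auto simp: assms m_assoc intro: l_inv_ex)
qed

lemma hom_image_rcoset:
  assumes "f \<in> hom G H" "N \<subseteq> carrier G" "x \<in> carrier G"
  shows "f ` (N #>\<^bsub>G\<^esub> x) = (f ` N) #>\<^bsub>H\<^esub> f x"
  using set_mult_hom[of f G H N "{x}"] assms by (simp add: r_coset_eq_set_mult)

lemma quot_gmod_simps [simp]:
  "carrier (quot_gmod M N) = (\<lambda>x. N #>\<^bsub>M\<^esub> x) ` carrier M" "mult (quot_gmod M N) = (<#>\<^bsub>M\<^esub>)"
  "one (quot_gmod M N) = N" "act (quot_gmod M N) = (\<lambda>g Y. act M g ` Y)"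
  by (auto simp: quot_gmod_def carrier_FactGroup)

lemma group_hom_quot_gmod:
  assumes "N \<lhd> M"
  shows "group_hom M (quot_gmod M N) (\<lambda>x. N #>\<^bsub>M\<^esub> x)"
proof -
  interpret normal N M by fact
  have "group (quot_gmod M N)"
    using factorgroup_is_group by (rule group_cong) (simp_all add: carrier_FactGroup)
  then show ?thesis
    using r_coset_hom_Mod
    by (intro group_hom.intro group_hom_axioms.intro group_axioms)
      (auto simp: hom_def carrier_FactGroup)
qed

lemma kernel_quot_gmod:
  assumes "N \<lhd> M"
  shows "kernel M (quot_gmod M N) (\<lambda>x. N #>\<^bsub>M\<^esub> x) = N"
proof -
  interpret normal N M by fact
  have "N #>\<^bsub>M\<^esub> x = N \<longleftrightarrow> x \<in> N" if "x \<in> carrier M" for x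
    using that coset_join1[of N x] coset_join2[of x N] subgroup_axioms by blast
  then show ?thesis
    using subset by (auto simp: kernel_def)
qed

lemma istopology_quotient:
  "istopology (\<lambda>V. V \<subseteq> K \<and> openin X {x \<in> topspace X. f x \<in> V})"
  unfolding istopology_def
proof (intro conjI allI impI; (elim conjE)?)
  fix S T assume "openin X {x \<in> topspace X. f x \<in> S}" "openin X {x \<in> topspace X. f x \<in> T}"
  then have "openin X ({x \<in> topspace X. f x \<in> S} \<inter> {x \<in> topspace X. f x \<in> T})"
    by (rule openin_Int)
  then show "openin X {x \<in> topspace X. f x \<in> S \<inter> T}"
    by (rule back_subst) auto
next
  fix \<K> assume *: "\<forall>S\<in>\<K>. S \<subseteq> K \<and> openin X {x \<in> topspace X. f x \<in> S}"
  then show "\<Union>\<K> \<subseteq> K" by auto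
  have "openin X (\<Union>S\<in>\<K>. {x \<in> topspace X. f x \<in> S})"
    using * by auto
  then show "openin X {x \<in> topspace X. f x \<in> \<Union>\<K>}"
    by (rule back_subst) auto
qed auto

lemma quotient_map_quot_gmod:
  assumes M: "topspace (gtop M) = carrier M"
  shows "quotient_map (gtop M) (gtop (quot_gmod M N)) (\<lambda>x. N #>\<^bsub>M\<^esub> x)"
proof -
  let ?K = "(\<lambda>x. N #>\<^bsub>M\<^esub> x) ` carrier M"
  have openin: "openin (gtop (quot_gmod M N)) V \<longleftrightarrow>
      V \<subseteq> ?K \<and> openin (gtop M) {x \<in> topspace (gtop M). N #>\<^bsub>M\<^esub> x \<in> V}" for V
    by (simp add: quot_gmod_def topology_inverse'[OF istopology_quotient] carrier_FactGroup)
  have "{x \<in> topspace (gtop M). N #>\<^bsub>M\<^esub> x \<in> ?K} = topspace (gtop M)"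
    using M by auto
  then have "topspace (gtop (quot_gmod M N)) = ?K"
    using openin[of ?K] openin[of "topspace (gtop (quot_gmod M N))"]
    by (intro subset_antisym openin_subset) simp_all
  then show ?thesis
    unfolding quotient_map_def by (simp add: openin M)
qed

section \<open>Compact modules and their block matrices\<close>

locale compact_module =
  fixes G :: "('g, 'c) tgroup_scheme" and R :: "('r, 'd) tring_scheme"
    and T :: "('g, 'r, 't, 'e) rgmod_scheme"
  assumes profinite_R: "profinite_cring R" and profinite_G: "profinite_group G"
    and compact_T: "compact_RG_module G R T"
begin

sublocale T: module R T
  using compact_T by (simp add: compact_RG_module_def)

sublocale G: group G
  using profinite_G by (simp add: profinite_group_def)

lemma topspaces:
  "topspace (gtop G) = carrier G" "topspace (rtop R) = carrier R" "topspace (mtop T) = carrier T"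
  using profinite_G profinite_R compact_T
  by (simp_all add: profinite_group_def profinite_cring_def compact_RG_module_def)

lemma mact_one: "x \<in> carrier T \<Longrightarrow> mact T \<one>\<^bsub>G\<^esub> x = x"
  and mact_mact: "\<lbrakk>g \<in> carrier G; h \<in> carrier G; x \<in> carrier T\<rbrakk> \<Longrightarrow>
    mact T (g \<otimes>\<^bsub>G\<^esub> h) x = mact T g (mact T h x)"
  and mact_add: "\<lbrakk>g \<in> carrier G; x \<in> carrier T; y \<in> carrier T\<rbrakk> \<Longrightarrow>
    mact T g (x \<oplus>\<^bsub>T\<^esub> y) = mact T g x \<oplus>\<^bsub>T\<^esub> mact T g y"
  and mact_smult: "\<lbrakk>g \<in> carrier G; r \<in> carrier R; x \<in> carrier T\<rbrakk> \<Longrightarrow>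
    mact T g (r \<odot>\<^bsub>T\<^esub> x) = r \<odot>\<^bsub>T\<^esub> mact T g x"
  using compact_T by (simp_all add: compact_RG_module_def)

lemma continuous_inv_G: "continuous_map (gtop G) (gtop G) (\<lambda>g. inv\<^bsub>G\<^esub> g)"
  and continuous_add_T: "continuous_map (prod_topology (mtop T) (mtop T)) (mtop T) (\<lambda>(x, y). x \<oplus>\<^bsub>T\<^esub> y)"
  and continuous_neg_T: "continuous_map (mtop T) (mtop T) (\<lambda>x. \<ominus>\<^bsub>T\<^esub> x)"
  and continuous_smult_T: "continuous_map (prod_topology (rtop R) (mtop T)) (mtop T) (\<lambda>(r, x). r \<odot>\<^bsub>T\<^esub> x)"
  and continuous_mact_T: "continuous_map (prod_topology (gtop G) (mtop T)) (mtop T) (\<lambda>(g, x). mact T g x)"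
  using compact_T profinite_G by (simp_all add: compact_RG_module_def profinite_group_def)

lemmas continuous_add = continuous_map_uncurried[OF continuous_add_T]
  and continuous_smult = continuous_map_uncurried[OF continuous_smult_T]
  and continuous_mact = continuous_map_uncurried[OF continuous_mact_T]

lemma continuous_neg: "continuous_map X (mtop T) f \<Longrightarrow> continuous_map X (mtop T) (\<lambda>x. \<ominus>\<^bsub>T\<^esub> f x)"
  using continuous_map_compose[OF _ continuous_neg_T] by (simp add: o_def)

lemma continuous_closed: "\<lbrakk>continuous_map X (mtop T) f; x \<in> topspace X\<rbrakk> \<Longrightarrow> f x \<in> carrier T"
  using continuous_map_image_subset_topspace[of X "mtop T" f] by (auto simp: topspaces)

lemma mact_closed [simp]: "\<lbrakk>g \<in> carrier G; x \<in> carrier T\<rbrakk> \<Longrightarrow> mact T g x \<in> carrier T"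
  using continuous_closed[OF continuous_mact_T] by (auto simp: topspaces)

lemma mact_hom: "g \<in> carrier G \<Longrightarrow> abelian_group_hom T T (mact T g)"
proof (rule abelian_group_homI)
  show "group_hom (add_monoid T) (add_monoid T) (mact T g)" if "g \<in> carrier G"
    using that by unfold_locales (auto simp: hom_def mact_add)
qed unfold_locales

lemma mact_zero [simp]: "g \<in> carrier G \<Longrightarrow> mact T g \<zero>\<^bsub>T\<^esub> = \<zero>\<^bsub>T\<^esub>"
  using mact_hom by (rule abelian_group_hom.hom_zero)

lemma mact_surj: "g \<in> carrier G \<Longrightarrow> mact T g ` carrier T = carrier T"
proof (intro equalityI subsetI)
  fix t assume "g \<in> carrier G" "t \<in> carrier T"
  then have "t = mact T g (mact T (inv\<^bsub>G\<^esub> g) t)" "mact T (inv\<^bsub>G\<^esub> g) t \<in> carrier T"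
    by (auto simp: mact_one simp flip: mact_mact)
  then show "t \<in> mact T g ` carrier T" by blast
qed auto

lemma topological_gmodule_gmod_of: "topological_gmodule G (gmod_of T)"
proof (intro topological_gmodule.intro topological_gmodule_axioms.intro)
  show "comm_group (gmod_of T)"
    using T.M.a_comm_group by (rule comm_group_cong) (auto simp: gmod_of_def)
  have inv: "inv\<^bsub>gmod_of T\<^esub> x = \<ominus>\<^bsub>T\<^esub> x" for x
    unfolding gmod_of_def m_inv_def a_inv_def by simp
  have top: "gtop (gmod_of T) = mtop T"
    by (simp add: gmod_of_def)
  show "continuous_map (gtop (gmod_of T)) (gtop (gmod_of T)) (\<lambda>x. inv\<^bsub>gmod_of T\<^esub> x)"
    unfolding inv top by (rule continuous_neg_T)
qed (use profinite_G compact_T G.group_axioms in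
    \<open>auto simp: gmod_of_def profinite_group_def compact_RG_module_def\<close>)

lemma group_gmod_of: "group (gmod_of T)"
  using topological_gmodule.axioms(2)[OF topological_gmodule_gmod_of] by (rule comm_group.axioms(2))

lemma subgroup_hom_image:
  assumes "group H" "f \<in> hom (gmod_of T) H"
  shows "subgroup (f ` carrier T) H"
  using group_hom.img_is_subgroup[OF group_hom.intro[OF group_gmod_of]] assms
  by (simp add: group_hom_axioms_def gmod_of_def)

subsection \<open>The action on matrices\<close>

lemma mat_act_closed [simp]: "\<lbrakk>g \<in> carrier G; X \<in> matrices T m n\<rbrakk> \<Longrightarrow> mat_act T m n g X \<in> matrices T m n"
  by (rule matrixI) (auto simp: mat_entry matrix_entry)

lemma mat_act_one: "X \<in> matrices T m n \<Longrightarrow> mat_act T m n \<one>\<^bsub>G\<^esub> X = X"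
  by (rule matrix_eqI[of _ m n]) (auto simp: mat_entry matrix_entry mact_one matrix_extensional)

lemma mat_act_act: "\<lbrakk>g \<in> carrier G; h \<in> carrier G; X \<in> matrices T m n\<rbrakk> \<Longrightarrow>
    mat_act T m n (g \<otimes>\<^bsub>G\<^esub> h) X = mat_act T m n g (mat_act T m n h X)"
  by (rule matrix_eqI[of _ m n]) (auto simp: mat_entry matrix_entry mact_mact)

lemma mat_act_add: "\<lbrakk>g \<in> carrier G; X \<in> matrices T m n; Y \<in> matrices T m n\<rbrakk> \<Longrightarrow>
    mat_act T m n g (mat_add T m n X Y) = mat_add T m n (mat_act T m n g X) (mat_act T m n g Y)"
  by (rule matrix_eqI[of _ m n]) (auto simp: mat_entry matrix_entry mact_add)

lemma mat_act_corner: "g \<in> carrier G \<Longrightarrow>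
    mat_act T m n g (mat_corner T m n t) = mat_corner T m n (mact T g t)"
  by (rule matrix_eqI[of _ m n]) (auto simp: mat_entry)

lemma mat_act_lmult:
  assumes g: "g \<in> carrier G" and P: "P \<in> matrices R m m" and X: "X \<in> matrices T m n"
  shows "mat_act T m n g (mat_lmult T m n P X) = mat_lmult T m n P (mat_act T m n g X)"
proof (rule matrix_eqI)
  fix i j assume ij: "i \<in> {1..m}" "j \<in> {1..n}"
  have "mact T g (\<Oplus>\<^bsub>T\<^esub>l\<in>{1..m}. P (i, l) \<odot>\<^bsub>T\<^esub> X (l, j)) =
      (\<Oplus>\<^bsub>T\<^esub>l\<in>{1..m}. mact T g (P (i, l) \<odot>\<^bsub>T\<^esub> X (l, j)))"
    using ij matrix_entry[OF P] matrix_entry[OF X]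
    by (intro abelian_group_hom.a_hom_finsum[OF mact_hom[OF g]]) auto
  also have "\<dots> = (\<Oplus>\<^bsub>T\<^esub>l\<in>{1..m}. P (i, l) \<odot>\<^bsub>T\<^esub> mat_act T m n g X (l, j))"
    using g ij matrix_entry[OF P] matrix_entry[OF X]
    by (intro T.M.finsum_cong') (auto simp: mat_act_entry mact_smult)
  finally show "mat_act T m n g (mat_lmult T m n P X) (i, j) =
      mat_lmult T m n P (mat_act T m n g X) (i, j)"
    using ij by (simp add: mat_act_entry mat_lmult_entry)
qed auto

lemma mat_act_rmult:
  assumes "g \<in> carrier G" "Q \<in> matrices R n n" "X \<in> matrices T m n"
  shows "mat_act T m n g (mat_rmult T m n X Q) = mat_rmult T m n (mat_act T m n g X) Q"
  using assms by (simp add: T.mat_rmult_eq_transpose mat_act_lmult flip: mat_transpose_act)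

subsection \<open>Continuity of the matrix operations\<close>

abbreviation mat_topology :: "nat \<Rightarrow> nat \<Rightarrow> (nat \<times> nat \<Rightarrow> 't) topology" where
  "mat_topology m n \<equiv> product_topology (\<lambda>_. mtop T) (mat_idx m n)"

lemma continuous_matrixI:
  assumes "\<And>x. x \<in> topspace X \<Longrightarrow> f x \<in> extensional (mat_idx m n)"
    and "\<And>i j. \<lbrakk>i \<in> {1..m}; j \<in> {1..n}\<rbrakk> \<Longrightarrow> continuous_map X Y (\<lambda>x. f x (i, j))"
  shows "continuous_map X (product_topology (\<lambda>_. Y) (mat_idx m n)) f"
  using assms by (auto simp: continuous_map_componentwise mat_idx_def)

lemma continuous_matrix_entry:
  assumes "continuous_map X (product_topology (\<lambda>_. Y) (mat_idx m n)) f" "i \<in> {1..m}" "j \<in> {1..n}"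
  shows "continuous_map X Y (\<lambda>x. f x (i, j))"
  using assms by (auto simp: continuous_map_componentwise mat_idx_def)

lemma continuous_finsum:
  assumes "finite A" "\<And>i. i \<in> A \<Longrightarrow> continuous_map X (mtop T) (\<lambda>x. f x i)"
  shows "continuous_map X (mtop T) (\<lambda>x. \<Oplus>\<^bsub>T\<^esub>i\<in>A. f x i)"
  using assms
proof (induction A rule: finite_induct)
  case empty
  then show ?case by (simp add: topspaces)
next
  case (insert i A)
  have "continuous_map X (mtop T) (\<lambda>x. f x i \<oplus>\<^bsub>T\<^esub> (\<Oplus>\<^bsub>T\<^esub>i\<in>A. f x i))"
    using insert by (intro continuous_add) auto
  then show ?case
  proof (rule continuous_map_eq)
    fix x assume x: "x \<in> topspace X"
    have "f x j \<in> carrier T" if "j \<in> insert i A" for j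
      using continuous_closed[OF insert.prems[OF that] x] .
    then show "f x i \<oplus>\<^bsub>T\<^esub> (\<Oplus>\<^bsub>T\<^esub>i\<in>A. f x i) = (\<Oplus>\<^bsub>T\<^esub>i\<in>insert i A. f x i)"
      using insert.hyps by (simp add: T.M.finsum_insert Pi_iff)
  qed
qed

lemma continuous_lmult:
  assumes "continuous_map Z (product_topology (\<lambda>_. rtop R) (mat_idx m m)) P"
    and "continuous_map Z (mat_topology m n) X"
  shows "continuous_map Z (mat_topology m n) (\<lambda>z. mat_lmult T m n (P z) (X z))"
  by (rule continuous_matrixI)
    (use assms in \<open>auto simp: mat_entry intro!: continuous_finsum continuous_smult
      intro: continuous_matrix_entry\<close>)

lemma continuous_rmult:
  assumes "continuous_map Z (mat_topology m n) X"
    and "continuous_map Z (product_topology (\<lambda>_. rtop R) (mat_idx n n)) Q"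
  shows "continuous_map Z (mat_topology m n) (\<lambda>z. mat_rmult T m n (X z) (Q z))"
  by (rule continuous_matrixI)
    (use assms in \<open>auto simp: mat_entry intro!: continuous_finsum continuous_smult
      intro: continuous_matrix_entry\<close>)

lemma continuous_mat_act:
  assumes "continuous_map Z (gtop G) u" "continuous_map Z (mat_topology m n) X"
  shows "continuous_map Z (mat_topology m n) (\<lambda>z. mat_act T m n (u z) (X z))"
  by (rule continuous_matrixI)
    (use assms in \<open>auto simp: mat_entry intro!: continuous_mact intro: continuous_matrix_entry\<close>)

lemma continuous_mat_add:
  assumes "continuous_map Z (mat_topology m n) X" "continuous_map Z (mat_topology m n) Y"
  shows "continuous_map Z (mat_topology m n) (\<lambda>z. mat_add T m n (X z) (Y z))"
  by (rule continuous_matrixI)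
    (use assms in \<open>auto simp: mat_entry intro!: continuous_add intro: continuous_matrix_entry\<close>)

lemma continuous_mat_neg:
  "continuous_map (mat_topology m n) (mat_topology m n) (\<lambda>X. inv\<^bsub>mat_group T m n\<^esub> X)"
proof (rule continuous_map_eq)
  show "continuous_map (mat_topology m n) (mat_topology m n) (\<lambda>X. \<lambda>q\<in>mat_idx m n. \<ominus>\<^bsub>T\<^esub> X q)"
    by (auto simp: continuous_map_componentwise
        intro!: continuous_neg continuous_map_product_projection)
qed (simp add: T.M.inv_mat_group topspaces)

lemma topspace_unitri: "topspace (gtop (unitri R k)) = unitriangular R k"
  by (auto simp: unitri_def unitriangular_def Let_def topspaces)

end

subsection \<open>The group of block matrices\<close>

locale block_matrices = compact_module G R T
  for G :: "('g, 'c) tgroup_scheme" and R :: "('r, 'd) tring_scheme"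
    and T :: "('g, 'r, 't, 'e) rgmod_scheme" +
  fixes a b :: nat
begin

abbreviation "m \<equiv> a + 1"
abbreviation "n \<equiv> b + 1"
abbreviation "W \<equiv> calU R T a b"
abbreviation "Z \<equiv> calU_centre R T a b"
abbreviation "corners \<equiv> mat_corner T m n ` carrier T"

definition central_block :: "'t \<Rightarrow> ('r, 't) block" where
  "central_block t = (rmat_one R m, mat_corner T m n t, rmat_one R n)"

lemma carrier_calU: "carrier W = unitriangular R m \<times> matrices T m n \<times> unitriangular R n"
  by (simp add: calU_def)

lemma mult_calU: "(P, X, Q) \<otimes>\<^bsub>W\<^esub> (P', X', Q') =
    (rmat_mult R m P P', mat_add T m n (mat_lmult T m n P X') (mat_rmult T m n X Q'),
     rmat_mult R n Q Q')"
  by (simp add: calU_def)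

lemma one_calU: "\<one>\<^bsub>W\<^esub> = (rmat_one R m, mat_zero T m n, rmat_one R n)"
  by (simp add: calU_def)

lemma act_calU: "act W g (P, X, Q) = (P, mat_act T m n g X, Q)"
  by (simp add: calU_def)

lemma topspace_calU: "topspace (gtop W) = carrier W"
  by (simp add: calU_def topspace_unitri topspaces)

lemma calU_left_inverse:
  assumes "x \<in> carrier W"
  shows "\<exists>y\<in>carrier W. y \<otimes>\<^bsub>W\<^esub> x = \<one>\<^bsub>W\<^esub>"
proof -
  interpret P: group "unitri R m" by (rule T.R.group_unitri) (rule T.R.is_cring)
  interpret Q: group "unitri R n" by (rule T.R.group_unitri) (rule T.R.is_cring)
  obtain P X Q where x: "x = (P, X, Q)" "P \<in> unitriangular R m" "X \<in> matrices T m n"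
    "Q \<in> unitriangular R n"
    using assms by (auto simp: carrier_calU)
  obtain P' where P': "P' \<in> unitriangular R m" "rmat_mult R m P' P = rmat_one R m"
    using P.l_inv_ex[of P] x by auto
  obtain Q' where Q': "Q' \<in> unitriangular R n" "rmat_mult R n Q' Q = rmat_one R n"
    using Q.l_inv_ex[of Q] x by auto
  note [simp] = unitriangular_matrix
  define Y where "Y = inv\<^bsub>mat_group T m n\<^esub> (mat_lmult T m n P' X)"
  have Y: "Y \<in> matrices T m n"
    using P' x unfolding Y_def by (intro T.M.mat.inv_closed) simp
  have "mat_add T m n (mat_lmult T m n P' X) (mat_rmult T m n (mat_rmult T m n Y Q') Q) =
      mat_add T m n (mat_lmult T m n P' X) Y"
    using x Q' Y by (simp add: T.mat_rmult_rmult T.mat_rmult_one)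
  then have "(P', mat_rmult T m n Y Q', Q') \<otimes>\<^bsub>W\<^esub> x = \<one>\<^bsub>W\<^esub>"
    using x P' Q' by (simp add: mult_calU one_calU Y_def)
  moreover have "(P', mat_rmult T m n Y Q', Q') \<in> carrier W"
    using P' Q' Y by (simp add: carrier_calU)
  ultimately show ?thesis
    by blast
qed

lemma group_calU: "group W"
proof (rule groupI)
  note [simp] = carrier_calU mult_calU one_calU unitriangular_matrix
  show "x \<otimes>\<^bsub>W\<^esub> y \<in> carrier W" if "x \<in> carrier W" "y \<in> carrier W" for x y
    using that by (auto simp: T.R.unitriangular_mult)
  show "\<one>\<^bsub>W\<^esub> \<in> carrier W"
    by (simp add: T.R.rmat_one_unitriangular)
  show "x \<otimes>\<^bsub>W\<^esub> y \<otimes>\<^bsub>W\<^esub> z = x \<otimes>\<^bsub>W\<^esub> (y \<otimes>\<^bsub>W\<^esub> z)"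
    if "x \<in> carrier W" "y \<in> carrier W" "z \<in> carrier W" for x y z
    using that by (auto simp: T.R.rmat_mult_assoc T.mat_lmult_add T.mat_rmult_add T.mat_lmult_lmult
        T.mat_rmult_rmult T.mat_lmult_rmult T.R.rmat_mult_closed T.M.mat.m_assoc)
  show "\<one>\<^bsub>W\<^esub> \<otimes>\<^bsub>W\<^esub> x = x" if "x \<in> carrier W" for x
    using that T.mat_rmult_corner[of _ n "\<zero>\<^bsub>T\<^esub>" m]
    by (auto simp: T.R.rmat_mult_one_left T.mat_lmult_one T.M.mat_corner_zero)
qed (fact calU_left_inverse)

sublocale W: group W
  by (rule group_calU)

lemma central_block_mult:
  assumes "t \<in> carrier T" "(P, X, Q) \<in> carrier W"
  shows "central_block t \<otimes>\<^bsub>W\<^esub> (P, X, Q) = (P, mat_add T m n (mat_corner T m n t) X, Q)"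
    and "(P, X, Q) \<otimes>\<^bsub>W\<^esub> central_block t = (P, mat_add T m n (mat_corner T m n t) X, Q)"
proof -
  have PXQ: "P \<in> unitriangular R m" "X \<in> matrices T m n" "Q \<in> unitriangular R n"
    using assms(2) by (auto simp: carrier_calU)
  then show "central_block t \<otimes>\<^bsub>W\<^esub> (P, X, Q) = (P, mat_add T m n (mat_corner T m n t) X, Q)"
    "(P, X, Q) \<otimes>\<^bsub>W\<^esub> central_block t = (P, mat_add T m n (mat_corner T m n t) X, Q)"
    using assms(1) T.M.mat.m_comm[of X m n "mat_corner T m n t"]
    by (simp_all add: central_block_def mult_calU unitriangular_matrix
        T.R.rmat_mult_one_left T.R.rmat_mult_one_right
        T.mat_lmult_one T.mat_rmult_one T.mat_lmult_corner T.mat_rmult_corner)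
qed

lemma centre_eq: "Z = central_block ` carrier T"
  by (auto simp: calU_centre_def central_block_def)

lemma central_block_hom: "central_block \<in> hom (gmod_of T) W"
proof (rule homI)
  show "central_block t \<in> carrier W" if "t \<in> carrier (gmod_of T)" for t
    using that by (simp add: gmod_of_def central_block_def carrier_calU T.R.rmat_one_unitriangular)
  show "central_block (s \<otimes>\<^bsub>gmod_of T\<^esub> t) = central_block s \<otimes>\<^bsub>W\<^esub> central_block t"
    if "s \<in> carrier (gmod_of T)" "t \<in> carrier (gmod_of T)" for s t
    using that central_block_mult(1)[of s "rmat_one R m" "mat_corner T m n t" "rmat_one R n"]
    by (simp add: gmod_of_def central_block_def carrier_calU T.R.rmat_one_unitriangular
        T.M.mat_corner_add)
qed

lemma centre_normal: "Z \<lhd> W"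
proof (rule W.normalI)
  show "subgroup Z W"
    unfolding centre_eq by (rule subgroup_hom_image[OF group_calU central_block_hom])
  show "\<forall>x\<in>carrier W. Z #>\<^bsub>W\<^esub> x = x <#\<^bsub>W\<^esub> Z"
    using central_block_mult by (auto simp: r_coset_def l_coset_def centre_eq)
qed

lemma act_calU_hom: "g \<in> carrier G \<Longrightarrow> act W g \<in> hom W W"
  by (auto simp: hom_def carrier_calU mult_calU act_calU unitriangular_matrix T.R.unitriangular_mult
      mat_act_add mat_act_lmult mat_act_rmult)

lemma act_calU_coset:
  assumes g: "g \<in> carrier G" and x: "x \<in> carrier W"
  shows "act W g ` (Z #>\<^bsub>W\<^esub> x) = Z #>\<^bsub>W\<^esub> act W g x"
proof -
  have "act W g ` Z = central_block ` mact T g ` carrier T"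
    using g by (auto simp: centre_eq image_image central_block_def act_calU mat_act_corner)
  then have "act W g ` Z = Z"
    by (simp add: mact_surj[OF g] centre_eq)
  moreover have "Z \<subseteq> carrier W"
    using normal_imp_subgroup[OF centre_normal] by (rule subgroup.subset)
  ultimately show ?thesis
    using hom_image_rcoset[OF act_calU_hom[OF g] _ x] by simp
qed

end

section \<open>The modules attached to a partial defining system\<close>

locale defining_system = block_matrices G R T a b
  for G :: "('g, 'c) tgroup_scheme" and R :: "('r, 'd) tring_scheme"
    and T :: "('g, 'r, 't, 'e) rgmod_scheme"
    and a b +
  fixes \<phi> \<theta> :: "'g \<Rightarrow> nat \<times> nat \<Rightarrow> 'r"
  assumes system: "partial_defining_system G R a b \<phi> \<theta>"
begin

abbreviation "U \<equiv> frakU R T a b \<phi> \<theta>"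
abbreviation "U' \<equiv> frakU' R T a b \<phi> \<theta>"

lemma group_hom_system: "group_hom G (unitri R m) \<phi>" "group_hom G (unitri R n) \<theta>"
  using system G.group_axioms T.R.group_unitri[OF T.R.is_cring]
  by (auto simp: partial_defining_system_def intro!: group_hom.intro group_hom_axioms.intro)

lemma system_unitriangular [simp]:
  "g \<in> carrier G \<Longrightarrow> \<phi> g \<in> unitriangular R m" "g \<in> carrier G \<Longrightarrow> \<theta> g \<in> unitriangular R n"
  using group_hom_system[THEN group_hom.hom_closed] by simp_all

lemma system_matrix [simp]:
  "g \<in> carrier G \<Longrightarrow> \<phi> g \<in> matrices R m m" "g \<in> carrier G \<Longrightarrow> \<theta> g \<in> matrices R n n"
  by (simp_all add: unitriangular_matrix)

lemma system_mult:
  "\<lbrakk>g \<in> carrier G; h \<in> carrier G\<rbrakk> \<Longrightarrow> rmat_mult R m (\<phi> g) (\<phi> h) = \<phi> (g \<otimes>\<^bsub>G\<^esub> h)"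
  "\<lbrakk>g \<in> carrier G; h \<in> carrier G\<rbrakk> \<Longrightarrow> rmat_mult R n (\<theta> g) (\<theta> h) = \<theta> (g \<otimes>\<^bsub>G\<^esub> h)"
  using group_hom_system[THEN group_hom.hom_mult] by simp_all

lemma system_one: "\<phi> \<one>\<^bsub>G\<^esub> = rmat_one R m" "\<theta> \<one>\<^bsub>G\<^esub> = rmat_one R n"
  using group_hom_system[THEN group_hom.hom_one] by simp_all

lemma continuous_system:
  "continuous_map (gtop G) (gtop (unitri R m)) \<phi>"
  "continuous_map (gtop G) (gtop (unitri R n)) \<theta>"
  using system by (simp_all add: partial_defining_system_def)

lemma continuous_system_matrix:
  "continuous_map (gtop G) (product_topology (\<lambda>_. rtop R) (mat_idx m m)) \<phi>"
  "continuous_map (gtop G) (product_topology (\<lambda>_. rtop R) (mat_idx n n)) \<theta>"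
  using continuous_system by (simp_all add: unitri_def Let_def continuous_map_in_subtopology)

lemma continuous_system_inv:
  "continuous_map (gtop G) (product_topology (\<lambda>_. rtop R) (mat_idx n n)) (\<lambda>g. \<theta> (inv\<^bsub>G\<^esub> g))"
  using continuous_map_compose[OF continuous_inv_G continuous_system_matrix(2)] by (simp add: o_def)

lemma frakU_simps [simp]:
  "carrier U = matrices T m n" "mult U = mat_add T m n" "one U = mat_zero T m n"
  "gtop U = mat_topology m n"
  by (simp_all add: frakU_def)

lemma act_frakU: "g \<in> carrier G \<Longrightarrow> act U g X =
    mat_rmult T m n (mat_lmult T m n (\<phi> g) (mat_act T m n g X)) (\<theta> (inv\<^bsub>G\<^esub> g))"
  by (simp add: frakU_def group_hom.hom_inv[OF group_hom_system(2)])

sublocale U: comm_group U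
  rewrites "carrier U = matrices T m n" and "mult U = mat_add T m n" and "one U = mat_zero T m n"
  using comm_group_cong[OF T.M.comm_group_mat_group, of U m n] by (simp_all add: mat_group_simps)

lemma inv_frakU: "inv\<^bsub>U\<^esub> X = inv\<^bsub>mat_group T m n\<^esub> X"
  by (simp add: m_inv_def mat_group_simps)

lemma act_frakU_closed [simp]: "\<lbrakk>g \<in> carrier G; X \<in> matrices T m n\<rbrakk> \<Longrightarrow> act U g X \<in> matrices T m n"
  by (simp add: act_frakU)

lemma act_frakU_add:
  assumes "g \<in> carrier G" "X \<in> matrices T m n" "Y \<in> matrices T m n"
  shows "act U g (mat_add T m n X Y) = mat_add T m n (act U g X) (act U g Y)"
  using assms by (simp add: act_frakU mat_act_add T.mat_lmult_add T.mat_rmult_add)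

lemma act_frakU_corner:
  "\<lbrakk>g \<in> carrier G; t \<in> carrier T\<rbrakk> \<Longrightarrow> act U g (mat_corner T m n t) = mat_corner T m n (mact T g t)"
  by (simp add: act_frakU mat_act_corner T.mat_lmult_corner T.mat_rmult_corner)

lemma act_frakU_act:
  assumes "g \<in> carrier G" "h \<in> carrier G" "X \<in> matrices T m n"
  shows "act U (g \<otimes>\<^bsub>G\<^esub> h) X = act U g (act U h X)"
proof -
  have "act U g (act U h X) = mat_rmult T m n (mat_rmult T m n
      (mat_lmult T m n (\<phi> g) (mat_lmult T m n (\<phi> h) (mat_act T m n (g \<otimes>\<^bsub>G\<^esub> h) X)))
        (\<theta> (inv\<^bsub>G\<^esub> h))) (\<theta> (inv\<^bsub>G\<^esub> g))"
    using assms by (simp add: act_frakU mat_act_act mat_act_lmult mat_act_rmult T.mat_lmult_rmult)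
  also have "\<dots> = act U (g \<otimes>\<^bsub>G\<^esub> h) X"
    using assms
    by (simp add: act_frakU T.mat_lmult_lmult T.mat_rmult_rmult system_mult G.inv_mult_group)
  finally show ?thesis ..
qed

lemma continuous_act_frakU:
  "continuous_map (prod_topology (gtop G) (mat_topology m n)) (mat_topology m n) (\<lambda>(g, X). act U g X)"
proof -
  let ?Z = "prod_topology (gtop G) (mat_topology m n)"
  have "continuous_map ?Z (mat_topology m n) (\<lambda>z. mat_rmult T m n
      (mat_lmult T m n (\<phi> (fst z)) (mat_act T m n (fst z) (snd z))) (\<theta> (inv\<^bsub>G\<^esub> (fst z))))"
    using continuous_map_compose[OF continuous_map_fst continuous_system_matrix(1)]
      continuous_map_compose[OF continuous_map_fst continuous_system_inv]
    by (intro continuous_rmult continuous_lmult continuous_mat_act continuous_map_fst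
        continuous_map_snd) (simp_all add: o_def)
  then show ?thesis
    by (rule continuous_map_eq) (auto simp: act_frakU topspaces)
qed

lemma topological_gmodule_frakU: "topological_gmodule G U"
proof (intro topological_gmodule.intro topological_gmodule_axioms.intro)
  show "continuous_map (prod_topology (gtop U) (gtop U)) (gtop U) (\<lambda>(X, Y). X \<otimes>\<^bsub>U\<^esub> Y)"
    by (simp add: case_prod_unfold continuous_mat_add continuous_map_fst continuous_map_snd)
  show "act U \<one>\<^bsub>G\<^esub> X = X" if "X \<in> carrier U" for X
    using that by (simp add: act_frakU system_one mat_act_one T.mat_lmult_one T.mat_rmult_one)
qed (use profinite_G act_frakU_act act_frakU_add continuous_act_frakU continuous_mat_neg G.group_axioms
      U.comm_group_axioms in \<open>auto simp: profinite_group_def inv_frakU topspaces\<close>)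

subsection \<open>Classes modulo the upper right entry\<close>

lemma corner_hom: "mat_corner T m n \<in> hom (gmod_of T) U"
  by (auto simp: hom_def gmod_of_def T.M.mat_corner_add)

lemma corners_normal: "corners \<lhd> U"
  by (intro U.subgroup_imp_normal subgroup_hom_image U.group_axioms corner_hom)

lemma corners_subset: "corners \<subseteq> matrices T m n"
  using T.M.mat_corner_closed by blast

lemma frakU'_eq: "U' = quot_gmod U corners"
  by (simp add: frakU'_def frakU_incl_def)

lemma coset_eq: "corners #>\<^bsub>U\<^esub> X = (\<lambda>t. mat_add T m n (mat_corner T m n t) X) ` carrier T"
  by (auto simp: r_coset_def)

lemma coset_subset: "X \<in> matrices T m n \<Longrightarrow> corners #>\<^bsub>U\<^esub> X \<subseteq> matrices T m n"
  using U.r_coset_subset_G corners_subset by blast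

lemma coset_eqI: "\<lbrakk>Y \<in> corners #>\<^bsub>U\<^esub> X; X \<in> matrices T m n\<rbrakk> \<Longrightarrow> corners #>\<^bsub>U\<^esub> Y = corners #>\<^bsub>U\<^esub> X"
  using U.repr_independence normal_imp_subgroup[OF corners_normal] by metis

lemma image_coset:
  assumes "f \<in> hom U U" "f ` corners = corners" "X \<in> matrices T m n"
  shows "f ` (corners #>\<^bsub>U\<^esub> X) = corners #>\<^bsub>U\<^esub> f X"
  using hom_image_rcoset[of f U U corners X] assms corners_subset by simp

lemma act_frakU_coset:
  assumes g: "g \<in> carrier G" and X: "X \<in> matrices T m n"
  shows "act U g ` (corners #>\<^bsub>U\<^esub> X) = corners #>\<^bsub>U\<^esub> act U g X"
proof (rule image_coset[OF _ _ X])
  show "act U g \<in> hom U U"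
    using g by (auto simp: hom_def act_frakU_add)
  have "act U g ` corners = mat_corner T m n ` mact T g ` carrier T"
    unfolding image_image using g by (intro image_cong) (simp_all add: act_frakU_corner)
  then show "act U g ` corners = corners"
    by (simp add: mact_surj[OF g])
qed

lemma rmult_coset:
  assumes Q: "Q \<in> unitriangular R n" and X: "X \<in> matrices T m n"
  shows "(\<lambda>Y. mat_rmult T m n Y Q) ` (corners #>\<^bsub>U\<^esub> X) = corners #>\<^bsub>U\<^esub> mat_rmult T m n X Q"
proof (rule image_coset[OF _ _ X])
  show "(\<lambda>Y. mat_rmult T m n Y Q) \<in> hom U U"
    using Q by (auto simp: hom_def T.mat_rmult_add unitriangular_matrix)
  show "(\<lambda>Y. mat_rmult T m n Y Q) ` corners = corners"
    unfolding image_image using Q by (intro image_cong) (simp_all add: T.mat_rmult_corner)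
qed

lemma block'_coset:
  assumes "(P, X, Q) \<in> carrier W"
  shows "block' P (corners #>\<^bsub>U\<^esub> X) Q = Z #>\<^bsub>W\<^esub> (P, X, Q)"
proof -
  have "Z #>\<^bsub>W\<^esub> (P, X, Q) = (\<lambda>t. (P, mat_add T m n (mat_corner T m n t) X, Q)) ` carrier T"
    using central_block_mult(1)[OF _ assms] by (auto simp: r_coset_def centre_eq)
  then show ?thesis
    by (auto simp: block'_def coset_eq)
qed

lemma quot_entry_coset:
  assumes "X \<in> matrices T m n" "i \<in> {1..m}" "j \<in> {1..n}" "(i, j) \<noteq> (1, n)"
  shows "quot_entry (corners #>\<^bsub>U\<^esub> X) i j = X (i, j)"
proof -
  have "(\<lambda>Y. Y (i, j)) ` (corners #>\<^bsub>U\<^esub> X) = (\<lambda>t. X (i, j)) ` carrier T"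
    unfolding coset_eq image_image
    by (rule image_cong) (use assms in \<open>auto simp: mat_entry matrix_entry\<close>)
  moreover have "carrier T \<noteq> {}"
    using T.M.zero_closed by blast
  ultimately show ?thesis
    by (simp add: quot_entry_def image_constant_conv)
qed

definition corner_free_rep :: "(nat \<times> nat \<Rightarrow> 't) set \<Rightarrow> nat \<times> nat \<Rightarrow> 't" where
  "corner_free_rep Y = (\<lambda>(i, j)\<in>mat_idx m n. if (i, j) = (1, n) then \<zero>\<^bsub>T\<^esub> else quot_entry Y i j)"

lemma clear_corner_eq:
  assumes X: "X \<in> matrices T m n"
  shows "X((1, n) := \<zero>\<^bsub>T\<^esub>) = mat_add T m n (mat_corner T m n (\<ominus>\<^bsub>T\<^esub> X (1, n))) X"
proof (rule matrix_eqI)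
  show "X((1, n) := \<zero>\<^bsub>T\<^esub>) \<in> extensional (mat_idx m n)"
    using matrix_extensional[OF X] by (simp add: extensional_def mat_idx_def)
  show "(X((1, n) := \<zero>\<^bsub>T\<^esub>)) (i, j) = mat_add T m n (mat_corner T m n (\<ominus>\<^bsub>T\<^esub> X (1, n))) X (i, j)"
    if "i \<in> {1..m}" "j \<in> {1..n}" for i j
    using that matrix_entry[OF X that] by (auto simp: mat_entry T.M.l_neg)
qed simp

lemma clear_corner_closed: "X \<in> matrices T m n \<Longrightarrow> X((1, n) := \<zero>\<^bsub>T\<^esub>) \<in> matrices T m n"
  using matrix_entry[of X m n T 1 n] by (simp add: clear_corner_eq)

lemma corner_free_rep_coset:
  assumes "X \<in> matrices T m n"
  shows "corner_free_rep (corners #>\<^bsub>U\<^esub> X) = X((1, n) := \<zero>\<^bsub>T\<^esub>)"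
proof (rule matrix_eqI)
  show "X((1, n) := \<zero>\<^bsub>T\<^esub>) \<in> extensional (mat_idx m n)"
    using clear_corner_closed[OF assms] by (rule matrix_extensional)
  show "corner_free_rep (corners #>\<^bsub>U\<^esub> X) (i, j) = (X((1, n) := \<zero>\<^bsub>T\<^esub>)) (i, j)"
    if "i \<in> {1..m}" "j \<in> {1..n}" for i j
    using that quot_entry_coset[OF assms that] by (simp add: corner_free_rep_def mat_idx_def)
qed (simp add: corner_free_rep_def)

lemma corner_free_rep_in_coset:
  assumes X: "X \<in> matrices T m n"
  shows "corner_free_rep (corners #>\<^bsub>U\<^esub> X) \<in> corners #>\<^bsub>U\<^esub> X"
proof -
  have "X (1, n) \<in> carrier T"
    using matrix_entry[OF X, of 1 n] by simp
  then have "X((1, n) := \<zero>\<^bsub>T\<^esub>) \<in> corners #>\<^bsub>U\<^esub> X"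
    unfolding clear_corner_eq[OF X] coset_eq by (intro imageI T.M.a_inv_closed)
  then show ?thesis
    by (simp only: corner_free_rep_coset[OF X])
qed

lemma corner_free_rep_closed:
  assumes "X \<in> matrices T m n"
  shows "corner_free_rep (corners #>\<^bsub>U\<^esub> X) \<in> matrices T m n"
  by (simp only: corner_free_rep_coset[OF assms] clear_corner_closed[OF assms])

lemma coset_corner_free_rep:
  "X \<in> matrices T m n \<Longrightarrow> corners #>\<^bsub>U\<^esub> corner_free_rep (corners #>\<^bsub>U\<^esub> X) = corners #>\<^bsub>U\<^esub> X"
  using coset_eqI[OF corner_free_rep_in_coset] .

lemma corner_free_rep_unique:
  assumes X: "X \<in> matrices T m n" and Y: "Y \<in> corners #>\<^bsub>U\<^esub> X" "Y (1, n) = \<zero>\<^bsub>T\<^esub>"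
  shows "Y = corner_free_rep (corners #>\<^bsub>U\<^esub> X)"
proof -
  have Y_closed: "Y \<in> matrices T m n"
    using coset_subset[OF X] Y(1) by blast
  have "corner_free_rep (corners #>\<^bsub>U\<^esub> X) = Y((1, n) := \<zero>\<^bsub>T\<^esub>)"
    using corner_free_rep_coset[OF Y_closed] unfolding coset_eqI[OF Y(1) X] .
  also have "\<dots> = Y"
    using Y(2) by (rule fun_upd_idem)
  finally show ?thesis ..
qed

lemma calU_lift_block':
  assumes X: "X \<in> matrices T m n"
  shows "calU_lift T b (block' P (corners #>\<^bsub>U\<^esub> X) Q) = (P, corner_free_rep (corners #>\<^bsub>U\<^esub> X), Q)"
  unfolding calU_lift_def block'_def
proof (rule the_equality)
  show "(P, corner_free_rep (corners #>\<^bsub>U\<^esub> X), Q) \<in> {P} \<times> (corners #>\<^bsub>U\<^esub> X) \<times> {Q} \<and>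
      fst (snd (P, corner_free_rep (corners #>\<^bsub>U\<^esub> X), Q)) (1, b + 1) = \<zero>\<^bsub>T\<^esub>"
    using corner_free_rep_in_coset[OF X] by (simp add: corner_free_rep_coset[OF X])
qed (use corner_free_rep_unique[OF X] in auto)

lemma continuous_clear_corner:
  "continuous_map (mat_topology m n) (mat_topology m n) (\<lambda>X. X((1, n) := \<zero>\<^bsub>T\<^esub>))"
proof (rule continuous_matrixI)
  show "X((1, n) := \<zero>\<^bsub>T\<^esub>) \<in> extensional (mat_idx m n)" if "X \<in> topspace (mat_topology m n)" for X
    using that clear_corner_closed by (intro matrix_extensional) (simp add: topspaces)
  show "continuous_map (mat_topology m n) (mtop T) (\<lambda>X. (X((1, n) := \<zero>\<^bsub>T\<^esub>)) (i, j))"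
    if "i \<in> {1..m}" "j \<in> {1..n}" for i j
    using that by (cases "(i, j) = (1, n)")
      (auto simp: topspaces mat_idx_def intro!: continuous_map_product_projection)
qed

lemma continuous_corner_free_rep: "continuous_map (gtop U') (mat_topology m n) corner_free_rep"
proof (rule continuous_compose_quotient_map)
  show "quotient_map (gtop U) (gtop U') (\<lambda>X. corners #>\<^bsub>U\<^esub> X)"
    unfolding frakU'_eq by (rule quotient_map_quot_gmod) (simp add: topspaces)
  have "continuous_map (mat_topology m n) (mat_topology m n) (\<lambda>X. corner_free_rep (corners #>\<^bsub>U\<^esub> X))"
    by (rule continuous_map_eq[OF continuous_clear_corner]) (simp add: corner_free_rep_coset topspaces)
  then show "continuous_map (gtop U) (mat_topology m n) (corner_free_rep \<circ> (\<lambda>X. corners #>\<^bsub>U\<^esub> X))"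
    by (simp add: o_def)
qed

lemma frakU_split_sequence:
  "topologically_split_sequence G (gmod_of T) U U' (frakU_incl T a b) (frakU_proj R T a b \<phi> \<theta>)
    (\<lambda>X. X (1, n))"
proof (intro topologically_split_sequence.intro topologically_split_sequence_axioms.intro
    topological_gmodule_gmod_of topological_gmodule_frakU)
  have incl: "frakU_incl T a b = mat_corner T m n"
    by (simp add: frakU_incl_def)
  have proj: "frakU_proj R T a b \<phi> \<theta> = (\<lambda>X. corners #>\<^bsub>U\<^esub> X)"
    by (simp add: frakU_proj_def frakU_incl_def fun_eq_iff)
  show "group_hom (gmod_of T) U (frakU_incl T a b)"
    unfolding incl
    by (intro group_hom.intro group_hom_axioms.intro group_gmod_of U.group_axioms corner_hom)
  show "group_hom U U' (frakU_proj R T a b \<phi> \<theta>)"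
    unfolding proj frakU'_eq by (rule group_hom_quot_gmod[OF corners_normal])
  show "kernel U U' (frakU_proj R T a b \<phi> \<theta>) = frakU_incl T a b ` carrier (gmod_of T)"
    unfolding proj frakU'_eq kernel_quot_gmod[OF corners_normal] by (simp add: incl gmod_of_def)
  show "frakU_incl T a b (act (gmod_of T) g x) = act U g (frakU_incl T a b x)"
    if "g \<in> carrier G" "x \<in> carrier (gmod_of T)" for g x
    using that by (simp add: incl gmod_of_def act_frakU_corner)
  show "frakU_proj R T a b \<phi> \<theta> (act U g X) = act U' g (frakU_proj R T a b \<phi> \<theta> X)"
    if "g \<in> carrier G" "X \<in> carrier U" for g X
    using that act_frakU_coset by (simp add: proj frakU'_eq)
  show "frakU_incl T a b x (1, n) = x" for x
    by (simp add: incl mat_entry)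
  show "continuous_map (gtop U) (gtop (gmod_of T)) (\<lambda>X. X (1, n))"
    using continuous_map_product_projection[of "(1, n)" "mat_idx m n" "\<lambda>_. mtop T"]
    by (simp add: gmod_of_def mat_idx_def)
  show "frakU_proj R T a b \<phi> \<theta> ` carrier U = carrier U'"
    by (simp add: proj frakU'_eq)
qed

definition product_block :: "('g \<Rightarrow> nat \<times> nat \<Rightarrow> 't) \<Rightarrow> 'g \<Rightarrow> 'g \<Rightarrow> nat \<times> nat \<Rightarrow> 't" where
  "product_block F g h =
    mat_add T m n (mat_lmult T m n (\<phi> g) (mat_act T m n g (F h))) (mat_rmult T m n (F g) (\<theta> h))"

lemma block_mult_act:
  assumes "g \<in> carrier G" "h \<in> carrier G"
  shows "(\<phi> g, F g, \<theta> g) \<otimes>\<^bsub>W\<^esub> act W g (\<phi> h, F h, \<theta> h) =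
    (\<phi> (g \<otimes>\<^bsub>G\<^esub> h), product_block F g h, \<theta> (g \<otimes>\<^bsub>G\<^esub> h))"
  using assms by (simp add: act_calU mult_calU system_mult product_block_def)

lemma rmult_act_frakU:
  assumes "g \<in> carrier G" "h \<in> carrier G" "Y \<in> matrices T m n"
  shows "mat_rmult T m n (act U g Y) (\<theta> (g \<otimes>\<^bsub>G\<^esub> h)) =
    mat_lmult T m n (\<phi> g) (mat_act T m n g (mat_rmult T m n Y (\<theta> h)))"
proof -
  have "inv\<^bsub>G\<^esub> g \<otimes>\<^bsub>G\<^esub> (g \<otimes>\<^bsub>G\<^esub> h) = h"
    using assms by (simp flip: G.m_assoc)
  then show ?thesis
    using assms by (simp add: act_frakU T.mat_rmult_rmult system_mult mat_act_rmult T.mat_lmult_rmult)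
qed

lemma d1_rmult:
  assumes f: "f \<in> carrier G \<rightarrow> matrices T m n" and g: "g \<in> carrier G" and h: "h \<in> carrier G"
    and F: "\<And>x. x \<in> carrier G \<Longrightarrow> F x = mat_rmult T m n (f x) (\<theta> x)"
  shows "mat_add T m n (mat_rmult T m n (d1 G U f (g, h)) (\<theta> (g \<otimes>\<^bsub>G\<^esub> h))) (F (g \<otimes>\<^bsub>G\<^esub> h)) =
    product_block F g h"
proof -
  interpret U: topological_gmodule G U
    by (rule topological_gmodule_frakU)
  let ?gh = "g \<otimes>\<^bsub>G\<^esub> h"
  have gh: "?gh \<in> carrier G"
    and f_closed: "f g \<in> matrices T m n" "f h \<in> matrices T m n" "f ?gh \<in> matrices T m n"
    using f g h by auto
  have "d1 G U f (g, h) \<in> matrices T m n"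
    using U.d1_closed[of f "(g, h)"] f g h by simp
  then have "mat_add T m n (mat_rmult T m n (d1 G U f (g, h)) (\<theta> ?gh)) (F ?gh) =
      mat_rmult T m n (mat_add T m n (d1 G U f (g, h)) (f ?gh)) (\<theta> ?gh)"
    using gh f_closed by (simp add: F T.mat_rmult_add)
  also have "mat_add T m n (d1 G U f (g, h)) (f ?gh) = mat_add T m n (act U g (f h)) (f g)"
    using U.d1_mult_cancel[of f g h] f g h by simp
  also have "mat_rmult T m n (mat_add T m n (act U g (f h)) (f g)) (\<theta> ?gh) =
      mat_add T m n (mat_rmult T m n (act U g (f h)) (\<theta> ?gh)) (mat_rmult T m n (f g) (\<theta> ?gh))"
    using g gh f_closed by (simp add: T.mat_rmult_add)
  also have "mat_rmult T m n (f g) (\<theta> ?gh) = mat_rmult T m n (F g) (\<theta> h)"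
    using g h f_closed by (simp add: F T.mat_rmult_rmult system_mult)
  finally show ?thesis
    using g h f_closed by (simp add: product_block_def F rmult_act_frakU)
qed

end

section \<open>Massey products\<close>

locale massey_system = defining_system G R T a b \<phi> \<theta>
  for G :: "('g, 'c) tgroup_scheme" and R :: "('r, 'd) tring_scheme"
    and T :: "('g, 'r, 't, 'e) rgmod_scheme"
    and a b \<phi> \<theta> +
  fixes \<kappa>' :: "'g \<Rightarrow> (nat \<times> nat \<Rightarrow> 't) set" and \<rho> :: "'g \<Rightarrow> ('r, 't) block set"
  assumes cocycle: "\<kappa>' \<in> carrier (Z1 G U')"
    and \<rho>: "g \<in> carrier G \<Longrightarrow> \<rho> g = block' (\<phi> g) ((\<lambda>X. mat_rmult T m n X (\<theta> g)) ` \<kappa>' g) (\<theta> g)"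
begin

definition upper_block :: "'g \<Rightarrow> nat \<times> nat \<Rightarrow> 't" where
  "upper_block g = corner_free_rep ((\<lambda>Y. mat_rmult T m n Y (\<theta> g)) ` \<kappa>' g)"

abbreviation lift :: "'g \<Rightarrow> ('r, 't) block" where
  "lift g \<equiv> (\<phi> g, upper_block g, \<theta> g)"

definition \<kappa> :: "'g \<Rightarrow> nat \<times> nat \<Rightarrow> 't" where
  "\<kappa> g = mat_rmult T m n (upper_block g) (\<theta> (inv\<^bsub>G\<^esub> g))"

lemma \<kappa>'_C1: "\<kappa>' \<in> C1 G U'"
  using cocycle by (simp add: Z1_def)

lemma \<kappa>'_corner_free_rep:
  assumes "g \<in> carrier G"
  shows "corner_free_rep (\<kappa>' g) \<in> matrices T m n"
    and "corners #>\<^bsub>U\<^esub> corner_free_rep (\<kappa>' g) = \<kappa>' g"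
proof -
  have "\<kappa>' g \<in> carrier U'"
    using \<kappa>'_C1 assms by (auto simp: C1_def)
  then obtain Y where "Y \<in> matrices T m n" "\<kappa>' g = corners #>\<^bsub>U\<^esub> Y"
    by (auto simp: frakU'_eq)
  then show "corner_free_rep (\<kappa>' g) \<in> matrices T m n" "corners #>\<^bsub>U\<^esub> corner_free_rep (\<kappa>' g) = \<kappa>' g"
    using corner_free_rep_closed coset_corner_free_rep by simp_all
qed

lemma rmult_\<kappa>':
  assumes g: "g \<in> carrier G"
  shows "(\<lambda>Y. mat_rmult T m n Y (\<theta> g)) ` \<kappa>' g =
    corners #>\<^bsub>U\<^esub> mat_rmult T m n (corner_free_rep (\<kappa>' g)) (\<theta> g)"
  using rmult_coset[OF system_unitriangular(2)[OF g] \<kappa>'_corner_free_rep(1)[OF g]]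
  by (simp add: \<kappa>'_corner_free_rep(2)[OF g])

lemma rmult_\<kappa>'_closed:
  "g \<in> carrier G \<Longrightarrow> mat_rmult T m n (corner_free_rep (\<kappa>' g)) (\<theta> g) \<in> matrices T m n"
  using \<kappa>'_corner_free_rep(1) by simp

lemma upper_block_closed [simp]: "g \<in> carrier G \<Longrightarrow> upper_block g \<in> matrices T m n"
  by (simp add: upper_block_def rmult_\<kappa>' rmult_\<kappa>'_closed corner_free_rep_closed)

lemma upper_block_eq: "g \<in> carrier G \<Longrightarrow>
    upper_block g = (mat_rmult T m n (corner_free_rep (\<kappa>' g)) (\<theta> g))((1, n) := \<zero>\<^bsub>T\<^esub>)"
  by (simp add: upper_block_def rmult_\<kappa>' rmult_\<kappa>'_closed corner_free_rep_coset)

lemma upper_block_corner: "g \<in> carrier G \<Longrightarrow> upper_block g (1, n) = \<zero>\<^bsub>T\<^esub>"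
  by (simp add: upper_block_eq)

lemma coset_upper_block: "g \<in> carrier G \<Longrightarrow>
    corners #>\<^bsub>U\<^esub> upper_block g = corners #>\<^bsub>U\<^esub> mat_rmult T m n (corner_free_rep (\<kappa>' g)) (\<theta> g)"
  by (simp add: upper_block_def rmult_\<kappa>' rmult_\<kappa>'_closed coset_corner_free_rep)

lemma \<rho>_eq: "g \<in> carrier G \<Longrightarrow> \<rho> g = block' (\<phi> g) (corners #>\<^bsub>U\<^esub> upper_block g) (\<theta> g)"
  by (simp add: \<rho> rmult_\<kappa>' coset_upper_block)

lemma calU_lift_\<rho>: "g \<in> carrier G \<Longrightarrow> calU_lift T b (\<rho> g) = lift g"
  by (simp add: \<rho> rmult_\<kappa>' rmult_\<kappa>'_closed calU_lift_block') (simp add: upper_block_def rmult_\<kappa>')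

lemma \<kappa>_closed [simp]: "g \<in> carrier G \<Longrightarrow> \<kappa> g \<in> matrices T m n"
  by (simp add: \<kappa>_def)

lemma \<kappa>_rmult: "g \<in> carrier G \<Longrightarrow> mat_rmult T m n (\<kappa> g) (\<theta> g) = upper_block g"
  by (simp add: \<kappa>_def T.mat_rmult_rmult system_mult system_one T.mat_rmult_one)

lemma coset_\<kappa>:
  assumes g: "g \<in> carrier G"
  shows "corners #>\<^bsub>U\<^esub> \<kappa> g = \<kappa>' g"
proof -
  have \<theta>: "\<theta> (inv\<^bsub>G\<^esub> g) \<in> unitriangular R n"
    using g by simp
  have "corners #>\<^bsub>U\<^esub> \<kappa> g = (\<lambda>Y. mat_rmult T m n Y (\<theta> (inv\<^bsub>G\<^esub> g))) ` (corners #>\<^bsub>U\<^esub> upper_block g)"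
    unfolding \<kappa>_def using rmult_coset[OF \<theta> upper_block_closed[OF g]] ..
  also have "\<dots> = corners #>\<^bsub>U\<^esub> corner_free_rep (\<kappa>' g)"
    unfolding coset_upper_block[OF g] rmult_coset[OF \<theta> rmult_\<kappa>'_closed[OF g]]
    using g \<kappa>'_corner_free_rep(1)[OF g]
    by (simp add: T.mat_rmult_rmult system_mult system_one T.mat_rmult_one)
  finally show ?thesis
    using \<kappa>'_corner_free_rep(2)[OF g] by simp
qed

lemma continuous_upper_block: "continuous_map (gtop G) (mat_topology m n) upper_block"
proof -
  have "continuous_map (gtop G) (gtop U') \<kappa>'"
    using \<kappa>'_C1 by (simp add: C1_def)
  from continuous_map_compose[OF this continuous_corner_free_rep]
  have "continuous_map (gtop G) (mat_topology m n) (\<lambda>g. corner_free_rep (\<kappa>' g))"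
    by (simp add: o_def)
  then have "continuous_map (gtop G) (mat_topology m n)
      (\<lambda>g. mat_rmult T m n (corner_free_rep (\<kappa>' g)) (\<theta> g))"
    by (intro continuous_rmult continuous_system_matrix)
  from continuous_map_compose[OF this continuous_clear_corner]
  show ?thesis
    by (rule continuous_map_eq) (simp add: upper_block_eq topspaces)
qed

lemma continuous_\<kappa>: "continuous_map (gtop G) (mat_topology m n) \<kappa>"
  using continuous_rmult[OF continuous_upper_block continuous_system_inv] by (simp add: \<kappa>_def[abs_def])

lemma \<kappa>_C1: "(\<lambda>g\<in>carrier G. \<kappa> g) \<in> C1 G U"
  using topological_gmodule.C1_restrictI[OF topological_gmodule_frakU] continuous_\<kappa> by simp

lemma massey_cocycle_entry:
  assumes g: "g \<in> carrier G" and h: "h \<in> carrier G"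
  shows "massey_cocycle G T a b \<rho> (g, h) = product_block upper_block g h (1, n)"
proof -
  have first: "1 \<in> {1..m}" and last: "n \<in> {1..n}"
    by auto
  note closed = unitriangular_entry[OF system_unitriangular(1)[OF g] first]
    unitriangular_entry[OF system_unitriangular(2)[OF h] _ last]
    matrix_entry[OF upper_block_closed[OF h] _ last] matrix_entry[OF upper_block_closed[OF g] first]
  have "mat_lmult T m n (\<phi> g) (mat_act T m n g (upper_block h)) (1, n) =
      (\<Oplus>\<^bsub>T\<^esub>l\<in>{2..m}. \<phi> g (1, l) \<odot>\<^bsub>T\<^esub> mact T g (upper_block h (l, n)))"
    unfolding mat_lmult_entry[OF first last]
  proof (rule T.M.add.finprod_mono_neutral_cong_right)
    show "\<phi> g (1, l) \<odot>\<^bsub>T\<^esub> mat_act T m n g (upper_block h) (l, n) = \<zero>\<^bsub>T\<^esub>" if "l \<in> {1..m} - {2..m}" for l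
    proof -
      have "l = 1" using that by auto
      then show ?thesis
        using g closed(1)[OF first] upper_block_corner[OF h] by (simp add: mat_act_entry)
    qed
  qed (use g closed in \<open>auto simp: mat_act_entry\<close>)
  moreover have "mat_rmult T m n (upper_block g) (\<theta> h) (1, n) =
      (\<Oplus>\<^bsub>T\<^esub>l\<in>{1..b}. \<theta> h (l, n) \<odot>\<^bsub>T\<^esub> upper_block g (1, l))"
    unfolding mat_rmult_entry[OF first last]
  proof (rule T.M.add.finprod_mono_neutral_cong_right)
    show "\<theta> h (l, n) \<odot>\<^bsub>T\<^esub> upper_block g (1, l) = \<zero>\<^bsub>T\<^esub>" if "l \<in> {1..n} - {1..b}" for l
    proof -
      have "l = n" using that by auto
      then show ?thesis
        using closed(2)[OF last] upper_block_corner[OF g] by simp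
    qed
  qed (use closed in auto)
  ultimately show ?thesis
    using g h by (simp add: massey_cocycle_def calU_lift_\<rho> product_block_def mat_add_entry)
qed

lemma
  assumes g: "g \<in> carrier G" and h: "h \<in> carrier G"
  shows massey_cocycle_closed: "massey_cocycle G T a b \<rho> (g, h) \<in> carrier T"
    and d1_\<kappa>_eq_corner:
      "d1 G U (\<lambda>g\<in>carrier G. \<kappa> g) (g, h) = mat_corner T m n (massey_cocycle G T a b \<rho> (g, h))"
    and product_block_upper_block:
      "product_block upper_block g h =
        mat_add T m n (mat_corner T m n (massey_cocycle G T a b \<rho> (g, h))) (upper_block (g \<otimes>\<^bsub>G\<^esub> h))"
proof -
  interpret split: topologically_split_sequence G "gmod_of T" U U' "frakU_incl T a b"
    "frakU_proj R T a b \<phi> \<theta>" "\<lambda>X. X (1, n)"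
    by (rule frakU_split_sequence)
  let ?\<kappa> = "\<lambda>g\<in>carrier G. \<kappa> g"
  have "d1 G U ?\<kappa> (g, h) \<in> frakU_incl T a b ` carrier (gmod_of T)"
    using g h cocycle coset_\<kappa>
    by (intro split.d1_lift_in_image[where c = \<kappa>']) (auto simp: frakU_proj_def frakU_incl_def)
  then obtain s where s: "s \<in> carrier T" "d1 G U ?\<kappa> (g, h) = mat_corner T m n s"
    by (auto simp: frakU_incl_def gmod_of_def)
  have product: "product_block upper_block g h =
      mat_add T m n (mat_corner T m n s) (upper_block (g \<otimes>\<^bsub>G\<^esub> h))"
    using d1_rmult[of ?\<kappa> g h upper_block] g h s by (simp add: \<kappa>_rmult T.mat_rmult_corner)
  have "massey_cocycle G T a b \<rho> (g, h) = s"
    unfolding massey_cocycle_entry[OF g h] product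
    using s(1) upper_block_corner[of "g \<otimes>\<^bsub>G\<^esub> h"] g h by (simp add: mat_entry)
  then show "massey_cocycle G T a b \<rho> (g, h) \<in> carrier T"
    "d1 G U ?\<kappa> (g, h) = mat_corner T m n (massey_cocycle G T a b \<rho> (g, h))"
    "product_block upper_block g h =
      mat_add T m n (mat_corner T m n (massey_cocycle G T a b \<rho> (g, h))) (upper_block (g \<otimes>\<^bsub>G\<^esub> h))"
    using s product by simp_all
qed

theorem connecting_eq_massey_product:
  "connecting G (gmod_of T) U U' (frakU_incl T a b) (frakU_proj R T a b \<phi> \<theta>) (class1 G U' \<kappa>') =
    massey_product G T a b \<rho>"
  unfolding massey_product_def
proof (rule topologically_split_sequence.connecting_class1[OF frakU_split_sequence _ \<kappa>_C1])
  show "\<kappa>' \<in> carrier G \<rightarrow>\<^sub>E carrier U'"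
    using \<kappa>'_C1 by (simp add: C1_def)
  show "frakU_proj R T a b \<phi> \<theta> ((\<lambda>g\<in>carrier G. \<kappa> g) g) = \<kappa>' g" if "g \<in> carrier G" for g
    using that by (simp add: frakU_proj_def frakU_incl_def coset_\<kappa>)
  show "massey_cocycle G T a b \<rho> \<in> carrier G \<times> carrier G \<rightarrow>\<^sub>E carrier (gmod_of T)"
    using massey_cocycle_closed by (auto simp: gmod_of_def massey_cocycle_def)
  show "frakU_incl T a b (massey_cocycle G T a b \<rho> q) = d1 G U (\<lambda>g\<in>carrier G. \<kappa> g) q"
    if "q \<in> carrier G \<times> carrier G" for q
    using that d1_\<kappa>_eq_corner by (auto simp: frakU_incl_def)
qed

lemma lift_in_calU: "g \<in> carrier G \<Longrightarrow> lift g \<in> carrier W"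
  by (simp add: carrier_calU)

lemma \<rho>_coset: "g \<in> carrier G \<Longrightarrow> \<rho> g = Z #>\<^bsub>W\<^esub> lift g"
  using \<rho>_eq block'_coset[OF lift_in_calU] by simp

lemma lift_mult:
  assumes g: "g \<in> carrier G" and h: "h \<in> carrier G"
  shows "lift g \<otimes>\<^bsub>W\<^esub> act W g (lift h) =
    central_block (massey_cocycle G T a b \<rho> (g, h)) \<otimes>\<^bsub>W\<^esub> lift (g \<otimes>\<^bsub>G\<^esub> h)"
  using g h central_block_mult(1)[OF massey_cocycle_closed lift_in_calU[of "g \<otimes>\<^bsub>G\<^esub> h"]]
  by (simp add: block_mult_act product_block_upper_block)

lemma \<rho>_mult:
  assumes g: "g \<in> carrier G" and h: "h \<in> carrier G"
  shows "\<rho> (g \<otimes>\<^bsub>G\<^esub> h) = \<rho> g \<otimes>\<^bsub>calU' R T a b\<^esub> act (calU' R T a b) g (\<rho> h)"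
proof -
  interpret Z: normal Z W
    by (rule centre_normal)
  have gh: "g \<otimes>\<^bsub>G\<^esub> h \<in> carrier G"
    using g h by simp
  have "\<rho> g \<otimes>\<^bsub>calU' R T a b\<^esub> act (calU' R T a b) g (\<rho> h) =
      (Z #>\<^bsub>W\<^esub> lift g) <#>\<^bsub>W\<^esub> (act W g ` (Z #>\<^bsub>W\<^esub> lift h))"
    using g h by (simp add: calU'_def \<rho>_coset)
  also have "\<dots> = (Z #>\<^bsub>W\<^esub> lift g) <#>\<^bsub>W\<^esub> (Z #>\<^bsub>W\<^esub> act W g (lift h))"
    using act_calU_coset[OF g lift_in_calU[OF h]] by simp
  also have "\<dots> = Z #>\<^bsub>W\<^esub> (lift g \<otimes>\<^bsub>W\<^esub> act W g (lift h))"
    using g h by (intro Z.rcos_sum) (simp_all add: carrier_calU act_calU)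
  also have "\<dots> = Z #>\<^bsub>W\<^esub> lift (g \<otimes>\<^bsub>G\<^esub> h)"
  proof (rule W.repr_independence[symmetric])
    show "lift g \<otimes>\<^bsub>W\<^esub> act W g (lift h) \<in> Z #>\<^bsub>W\<^esub> lift (g \<otimes>\<^bsub>G\<^esub> h)"
      using massey_cocycle_closed[OF g h] by (auto simp: lift_mult[OF g h] r_coset_def centre_eq)
  qed (use lift_in_calU[OF gh] Z.subgroup_axioms in auto)
  finally show ?thesis
    using \<rho>_coset[OF gh] by simp
qed

lemma continuous_\<rho>: "continuous_map (gtop G) (gtop (calU' R T a b)) \<rho>"
proof (rule continuous_map_eq)
  have "continuous_map (gtop G) (gtop W) lift"
    by (simp add: calU_def continuous_map_paired continuous_system continuous_upper_block)
  moreover have "continuous_map (gtop W) (gtop (calU' R T a b)) (\<lambda>x. Z #>\<^bsub>W\<^esub> x)"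
    unfolding calU'_def by (intro quotient_imp_continuous_map quotient_map_quot_gmod topspace_calU)
  ultimately have "continuous_map (gtop G) (gtop (calU' R T a b)) ((\<lambda>x. Z #>\<^bsub>W\<^esub> x) \<circ> lift)"
    by (rule continuous_map_compose)
  then show "continuous_map (gtop G) (gtop (calU' R T a b)) (\<lambda>g. Z #>\<^bsub>W\<^esub> lift g)"
    by (simp add: o_def)
qed (simp add: \<rho>_coset topspaces)

theorem proper_defining_system_\<rho>: "proper_defining_system G R T a b \<phi> \<theta> \<rho>"
  unfolding proper_defining_system_def
proof (intro conjI ballI)
  show "\<rho> \<in> carrier G \<rightarrow> carrier (calU' R T a b)"
    using lift_in_calU by (auto simp: calU'_def \<rho>_coset)
  show "\<exists>\<kappa>\<in>carrier G \<rightarrow> carrier U'. \<forall>g\<in>carrier G. \<rho> g = block' (\<phi> g) (\<kappa> g) (\<theta> g)"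
    by (rule bexI[of _ "\<lambda>g. corners #>\<^bsub>U\<^esub> upper_block g"]) (auto simp: \<rho>_eq frakU'_eq)
qed (fact continuous_\<rho> \<rho>_mult)+

lemma upper_block_lower_left:
  assumes g: "g \<in> carrier G" and ab: "a + b > 0"
  shows "upper_block g (a + 1, 1) = quot_entry (\<kappa>' g) (a + 1) 1"
proof -
  have not_corner: "(a + 1, 1) \<noteq> (1, n)"
    using ab by auto
  have "upper_block g (a + 1, 1) = mat_rmult T m n (corner_free_rep (\<kappa>' g)) (\<theta> g) (a + 1, 1)"
    unfolding upper_block_eq[OF g] using not_corner by (rule fun_upd_other)
  also have "\<dots> = corner_free_rep (\<kappa>' g) (a + 1, 1)"
    using system_unitriangular(2)[OF g] \<kappa>'_corner_free_rep(1)[OF g]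
    by (intro T.mat_rmult_first_column) simp_all
  also have "\<dots> = quot_entry (\<kappa>' g) (a + 1) 1"
    unfolding corner_free_rep_def
    by (subst restrict_apply') (use not_corner in \<open>auto simp: mat_idx_def\<close>)
  finally show ?thesis .
qed

theorem massey_arguments_\<rho>:
  assumes "a + b > 0"
    and "\<And>i g. \<lbrakk>i \<in> {1..a}; g \<in> carrier G\<rbrakk> \<Longrightarrow> \<alpha> i g = \<phi> g (i, i + 1)"
    and "\<And>i g. \<lbrakk>i \<in> {1..b}; g \<in> carrier G\<rbrakk> \<Longrightarrow> \<beta> i g = \<theta> g (i, i + 1)"
  shows "massey_arguments G T a b \<rho> \<alpha> (\<lambda>g. quot_entry (\<kappa>' g) (a + 1) 1) \<beta>"
  using assms upper_block_lower_left by (simp add: massey_arguments_def calU_lift_\<rho>)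

end

theorem theorem3p10:
  fixes G :: "'g tgroup" and R :: "'r tring" and T :: "('g, 'r, 't) rgmod"
    and a b :: nat
    and \<phi> \<theta> :: "'g \<Rightarrow> nat \<times> nat \<Rightarrow> 'r"
    and \<alpha> \<beta> :: "nat \<Rightarrow> 'g \<Rightarrow> 'r"
    and \<kappa>' :: "'g \<Rightarrow> (nat \<times> nat \<Rightarrow> 't) set"
    and \<rho> :: "'g \<Rightarrow> ('r, 't) block set"
  assumes "profinite_cring R"
    and "profinite_group G"
    and "compact_RG_module G R T"
    and "fin_gen_module R T"
    and "a + b \<ge> 2"
    and "partial_defining_system G R a b \<phi> \<theta>"
    and "\<And>i g. i \<in> {1..a} \<Longrightarrow> g \<in> carrier G \<Longrightarrow> \<alpha> i g = \<phi> g (i, i + 1)"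
    and "\<And>i g. i \<in> {1..b} \<Longrightarrow> g \<in> carrier G \<Longrightarrow> \<beta> i g = \<theta> g (i, i + 1)"
    and "\<kappa>' \<in> carrier (Z1 G (frakU' R T a b \<phi> \<theta>))"
    and "\<And>g. g \<in> carrier G \<Longrightarrow>
           \<rho> g = block' (\<phi> g) ((\<lambda>X. mat_rmult T (a + 1) (b + 1) X (\<theta> g)) ` \<kappa>' g) (\<theta> g)"
  shows "proper_defining_system G R T a b \<phi> \<theta> \<rho> \<and>
         massey_arguments G T a b \<rho> \<alpha> (\<lambda>g. quot_entry (\<kappa>' g) (a + 1) 1) \<beta> \<and>
         connecting G (gmod_of T) (frakU R T a b \<phi> \<theta>) (frakU' R T a b \<phi> \<theta>)
             (frakU_incl T a b) (frakU_proj R T a b \<phi> \<theta>)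
             (class1 G (frakU' R T a b \<phi> \<theta>) \<kappa>') =
           massey_product G T a b \<rho>"
proof -
  interpret massey_system G R T a b \<phi> \<theta> \<kappa>' \<rho>
    using assms by unfold_locales auto
  have "massey_arguments G T a b \<rho> \<alpha> (\<lambda>g. quot_entry (\<kappa>' g) (a + 1) 1) \<beta>"
    using assms(5,7,8) by (intro massey_arguments_\<rho>) auto
  then show ?thesis
    using proper_defining_system_\<rho> connecting_eq_massey_product by blast
qed

end
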